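(* If $T\ne K_1$ is a tree and if $\mathcal{F}$ is a family of graphs which contains a forest, then either $\mathrm{ex}(n,T,\mathcal{F})=\Theta(n^k)$ for some integer $k\le \alpha(T)$ or $\mathrm{ex}(n,T,\mathcal{F})=0$ for all sufficiently large $n$.
   Context: Graphs are finite and simple. $\alpha(T)$ denotes the independence number of $T$. A graph is $\mathcal{F}$-free, for a family of graphs $\mathcal{F}$, if it contains no (not necessarily induced) subgraph isomorphic to a member of $\mathcal{F}$. $\mathrm{ex}(n,T,\mathcal{F})$ is the maximum number of copies of $T$ (subgraphs isomorphic to $T$) that an $n$-vertex $\mathcal{F}$-free graph can have, with the convention that it is $0$ if there is no $\mathcal{F}$-free graph on $n$ vertices. Asymptotics are as $n\to\infty$, with $T$ and $\mathcal{F}$ fixed. *)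

theory Defs
  imports "HOL-Library.Landau_Symbols" "HOL-Library.Ramsey"
begin

record 'a ugraph =
  verts :: "'a set"
  edges :: "'a set set"

definition graph :: "'a ugraph \<Rightarrow> bool" where
  "graph G \<longleftrightarrow> finite (verts G) \<and> edges G \<subseteq> nsets (verts G) 2"

definition complete_graph :: "nat \<Rightarrow> nat ugraph" where
  "complete_graph n = \<lparr>verts = {..<n}, edges = nsets {..<n} 2\<rparr>"

definition subgraph :: "'a ugraph \<Rightarrow> 'a ugraph \<Rightarrow> bool" where
  "subgraph H G \<longleftrightarrow> graph H \<and> graph G \<and> verts H \<subseteq> verts G \<and> edges H \<subseteq> edges G"

definition graph_iso :: "'a ugraph \<Rightarrow> 'b ugraph \<Rightarrow> bool" where
  "graph_iso G H \<longleftrightarrow> (\<exists>f. bij_betw f (verts G) (verts H) \<and>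
     (\<forall>u\<in>verts G. \<forall>v\<in>verts G. {u, v} \<in> edges G \<longleftrightarrow> {f u, f v} \<in> edges H))"

definition connected_graph :: "'a ugraph \<Rightarrow> bool" where
  "connected_graph G \<longleftrightarrow> verts G \<noteq> {} \<and>
     (\<forall>u\<in>verts G. \<forall>v\<in>verts G. (u, v) \<in> {(x, y). {x, y} \<in> edges G}\<^sup>*)"

text \<open>A cycle is given by its cyclic sequence of at least three pairwise distinct vertices.\<close>

definition cycle_in :: "'a ugraph \<Rightarrow> 'a list \<Rightarrow> bool" where
  "cycle_in G xs \<longleftrightarrow> 3 \<le> length xs \<and> distinct xs \<and>
     (\<forall>i<length xs. {xs ! i, xs ! (Suc i mod length xs)} \<in> edges G)"

definition forest :: "'a ugraph \<Rightarrow> bool" where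
  "forest G \<longleftrightarrow> graph G \<and> (\<nexists>xs. cycle_in G xs)"

definition tree :: "'a ugraph \<Rightarrow> bool" where
  "tree G \<longleftrightarrow> forest G \<and> connected_graph G"

definition independence_number :: "'a ugraph \<Rightarrow> nat" where
  "independence_number G = Max {card S |S. S \<subseteq> verts G \<and> indep S (edges G)}"

definition free_of :: "'b ugraph set \<Rightarrow> 'a ugraph \<Rightarrow> bool" where
  "free_of \<F> G \<longleftrightarrow> \<not> (\<exists>F\<in>\<F>. \<exists>H. subgraph H G \<and> graph_iso H F)"

text \<open>Copies are unlabelled: subgraphs are counted, not embeddings.\<close>

definition num_copies :: "'a ugraph \<Rightarrow> 'b ugraph \<Rightarrow> nat" where
  "num_copies T G = card {H. subgraph H G \<and> graph_iso H T}"

text \<open>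
  Every finite graph is isomorphic to one with vertices in \<^typ>\<open>nat\<close>, so it suffices to let
  the host graphs range over graphs of that type. The set of attained values is finite
  (\<open>finite_copy_counts\<close> below), so \<^const>\<open>Max\<close> is its maximum whenever it is nonempty.
\<close>

definition copy_counts :: "nat \<Rightarrow> 'a ugraph \<Rightarrow> 'b ugraph set \<Rightarrow> nat set" where
  "copy_counts n T \<F> =
     {num_copies T G |G :: nat ugraph. graph G \<and> card (verts G) = n \<and> free_of \<F> G}"

definition ex_num :: "nat \<Rightarrow> 'a ugraph \<Rightarrow> 'b ugraph set \<Rightarrow> nat" where
  "ex_num n T \<F> = (if copy_counts n T \<F> = {} then 0 else Max (copy_counts n T \<F>))"

lemma finite_copy_counts: "finite (copy_counts n T \<F>)"
proof -
  have "num_copies T G \<le> 2 ^ n * 2 ^ (n choose 2)"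
    if G: "graph G" "card (verts G) = n" for G :: "nat ugraph"
  proof -
    let ?S = "{H. subgraph H G \<and> graph_iso H T}"
    let ?P = "Pow (verts G) \<times> Pow (nsets (verts G) 2)"
    have fin: "finite (verts G)" and sub: "edges G \<subseteq> nsets (verts G) 2"
      using G(1) by (auto simp: graph_def)
    have "inj_on (\<lambda>H. (verts H, edges H)) ?S"
      by (auto simp: inj_on_def)
    moreover have "(\<lambda>H. (verts H, edges H)) ` ?S \<subseteq> ?P"
      using sub by (auto simp: subgraph_def)
    moreover have "finite ?P"
      using fin by (simp add: finite_imp_finite_nsets)
    ultimately have "card ?S \<le> card ?P"
      by (rule card_inj_on_le)
    also have "card ?P = 2 ^ n * 2 ^ (n choose 2)"
      using fin G(2) by (simp add: card_cartesian_product card_Pow card_nsets finite_imp_finite_nsets)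
    finally show ?thesis
      by (simp add: num_copies_def)
  qed
  then have "copy_counts n T \<F> \<subseteq> {..2 ^ n * 2 ^ (n choose 2)}"
    by (auto simp: copy_counts_def)
  then show ?thesis
    using finite_subset by blast
qed

end

theory Submission
  imports Defs
begin

text \<open>
  Excluding a forest makes every host graph \<open>G\<close> degenerate, so its edges can be oriented with
  bounded out-degree; fix also an orientation of \<open>T\<close> and count the orientation-preserving
  embeddings \<open>f\<close>. Call a subtree \<open>K\<close> of \<open>T\<close> flexible at \<open>f\<close> if, keeping \<open>f\<close> fixed outside \<open>K\<close>, there
  are many pairwise disjoint ways to embed \<open>K\<close>. An edge entering \<open>K\<close> would leave only boundedly
  many choices for its head, so disjoint flexible subtrees are not joined by an edge, and
  blowing them all up simultaneously gives a blow-up of \<open>T\<close> inside \<open>G\<close>. Let \<open>k\<close> be the largest number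
  of subtrees for which arbitrarily large blow-ups occur in \<open>\<F>\<close>-free graphs; such blow-ups contain
  \<open>\<Omega>(n^k)\<close> copies of \<open>T\<close>, and choosing one vertex from each subtree shows \<open>k \<le> \<alpha>(T)\<close>.
  Conversely, for large \<open>n\<close> at most \<open>k\<close> flexible subtrees are pairwise disjoint, so by the
  Helly-type duality for subtrees of a tree some \<open>k\<close> vertices \<open>S\<close> meet all of them. The images of \<open>S\<close> can be
  chosen in \<open>n^k\<close> ways, after which every remaining component is not flexible and is embedded
  in boundedly many ways.
\<close>

section \<open>Forests built by adding vertices of degree at most one\<close>

text \<open>A forest given by a construction order, so that later arguments can add or remove one
  vertex of degree at most one at a time. Bare vertex and edge sets avoid rebuilding records at each
  step.\<close>

inductive peelable :: "'a set \<Rightarrow> 'a set set \<Rightarrow> bool" where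
  empty: "peelable {} {}"
| isolated: "peelable V E \<Longrightarrow> l \<notin> V \<Longrightarrow> peelable (insert l V) E"
| leaf: "peelable V E \<Longrightarrow> l \<notin> V \<Longrightarrow> p \<in> V \<Longrightarrow> peelable (insert l V) (insert {l, p} E)"

lemma peelable_finite: "peelable V E \<Longrightarrow> finite V"
  by (induction rule: peelable.induct) auto

lemma peelable_edge_subset: "peelable V E \<Longrightarrow> e \<in> E \<Longrightarrow> e \<subseteq> V"
  by (induction rule: peelable.induct) auto

lemma graph_edgeE:
  assumes "graph G" "e \<in> edges G"
  obtains u v where "e = {u, v}" "u \<noteq> v" "u \<in> verts G" "v \<in> verts G"
  using assms by (force simp: graph_def nsets_def card_2_iff)

lemma graph_edgeD:
  assumes "graph G" "{u, v} \<in> edges G"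
  shows "u \<noteq> v" "u \<in> verts G" "v \<in> verts G"
  using assms by (auto simp: graph_def nsets_def)

text \<open>A longest path inside \<open>V\<close> cannot be extended at its first vertex, so all
  neighbours of that vertex in \<open>V\<close> lie on the path. One of them is not the second
  vertex of the path and closes a cycle.\<close>

lemma exists_cycle_if_min_degree:
  assumes fin: "finite V" and ne: "V \<noteq> {}"
    and deg: "\<And>v. v \<in> V \<Longrightarrow> \<exists>a\<in>V. \<exists>b\<in>V. a \<noteq> b \<and> a \<noteq> v \<and> b \<noteq> v \<and> {v, a} \<in> edges G \<and> {v, b} \<in> edges G"
  shows "\<exists>xs. cycle_in G xs"
proof -
  define P where "P xs \<longleftrightarrow> xs \<noteq> [] \<and> distinct xs \<and> set xs \<subseteq> V \<and>
    (\<forall>i. Suc i < length xs \<longrightarrow> {xs ! i, xs ! Suc i} \<in> edges G)" for xs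
  obtain v where v: "v \<in> V" using ne by blast
  have Pv: "P [v]" using v by (simp add: P_def)
  have bnd: "length xs < Suc (card V)" if "P xs" for xs
    using that distinct_card[of xs] card_mono[OF fin, of "set xs"] by (auto simp: P_def)
  obtain xs where xs: "P xs" and max: "\<And>ys. P ys \<Longrightarrow> length ys \<le> length xs"
    using ex_has_greatest_nat[of P "[v]" length "Suc (card V)"] Pv bnd less_imp_le by metis
  have x0: "hd xs \<in> V" using xs by (auto simp: P_def)
  have hd: "hd xs = xs ! 0" using xs by (simp add: P_def hd_conv_nth)
  obtain a b where ab: "a \<in> V" "b \<in> V" "a \<noteq> b" "a \<noteq> hd xs" "b \<noteq> hd xs" "{hd xs, a} \<in> edges G" "{hd xs, b} \<in> edges G"
    using deg[OF x0] by blast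
  have ins: "u \<in> set xs" if "u \<in> V" "{hd xs, u} \<in> edges G" for u
  proof (rule ccontr)
    assume "u \<notin> set xs"
    then have "P (u # xs)"
      using xs that hd by (auto simp: P_def nth_Cons insert_commute split: nat.splits)
    then show False using max[of "u # xs"] by simp
  qed
  obtain u where u: "u \<in> V" "{hd xs, u} \<in> edges G" "u \<noteq> hd xs" "length xs > 1 \<longrightarrow> u \<noteq> xs ! 1"
    using ab by metis
  obtain j where j: "j < length xs" "xs ! j = u" using ins[OF u(1,2)] by (auto simp: in_set_conv_nth)
  have "j \<noteq> 0" using j u(3) hd by metis
  moreover have "j \<noteq> 1" using j u(4) by auto
  ultimately have j2: "j \<ge> 2" by linarith
  \<comment> \<open>The initial segment ending in \<open>u = xs ! j\<close>, closed by the edge from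
    \<open>u\<close> back to the head; \<open>j \<ge> 2\<close> gives the required length
    three.\<close>
  have "cycle_in G (take (Suc j) xs)"
    unfolding cycle_in_def
  proof (intro conjI allI impI)
    show "3 \<le> length (take (Suc j) xs)" using j j2 by simp
    show "distinct (take (Suc j) xs)" using xs by (simp add: P_def)
    fix i assume i: "i < length (take (Suc j) xs)"
    have len: "length (take (Suc j) xs) = Suc j" using j by simp
    show "{take (Suc j) xs ! i, take (Suc j) xs ! (Suc i mod length (take (Suc j) xs))} \<in> edges G"
    proof (cases "i = j")
      case True
      then show ?thesis using len u(2) hd j by (simp add: insert_commute)
    next
      case False
      then have "Suc i < Suc j" using i len by simp
      then show ?thesis using len xs j by (simp add: P_def)
    qed
  qed
  then show ?thesis by blast
qed

text \<open>Read contrapositively, the cycle criterion provides a vertex \<open>l\<close> with at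
  most one neighbour. Deleting it creates no cycle, and it returns as an isolated vertex or as a
  leaf.\<close>

lemma forest_peelable:
  "forest G \<Longrightarrow> peelable (verts G) (edges G)"
proof (induction "card (verts G)" arbitrary: G)
  case 0
  then have "verts G = {}" "edges G = {}"
    by (auto simp: forest_def graph_def nsets_def)
  then show ?case by (simp add: peelable.empty)
next
  case (Suc n)
  have g: "graph G" and nc: "\<nexists>xs. cycle_in G xs" using Suc.prems by (auto simp: forest_def)
  have fin: "finite (verts G)" using g by (simp add: graph_def)
  have ne: "verts G \<noteq> {}" using Suc.hyps(2) by auto
  obtain l where l: "l \<in> verts G" and
    uniq: "\<And>a b. a \<in> verts G \<Longrightarrow> b \<in> verts G \<Longrightarrow> a \<noteq> l \<Longrightarrow> b \<noteq> l \<Longrightarrow> {l, a} \<in> edges G \<Longrightarrow> {l, b} \<in> edges G \<Longrightarrow> a = b"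
    using exists_cycle_if_min_degree[OF fin ne, of G] nc by blast
  define G' where "G' = \<lparr>verts = verts G - {l}, edges = {e \<in> edges G. l \<notin> e}\<rparr>"
  have gg: "graph G'" using g by (auto simp: graph_def G'_def nsets_def)
  have cyc: "cycle_in G xs" if "cycle_in G' xs" for xs
    using that by (auto simp: cycle_in_def G'_def)
  have "forest G'"
    using gg nc cyc unfolding forest_def by blast
  moreover have "n = card (verts G')" using Suc.hyps(2) l fin by (simp add: G'_def)
  ultimately have p: "peelable (verts G') (edges G')" using Suc.hyps(1) by blast
  have V: "verts G = insert l (verts G')" "l \<notin> verts G'" using l by (auto simp: G'_def)
  show ?case
  proof (cases "\<exists>e\<in>edges G. l \<in> e")
    case False
    then have "edges G = edges G'" by (auto simp: G'_def)
    then show ?thesis using peelable.isolated[OF p V(2)] V(1) by simp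
  next
    case True
    then obtain q where q: "{l, q} \<in> edges G"
      using g by (metis graph_edgeE insert_iff insert_commute singletonD)
    have lq: "e = {l, q}" if e: "e \<in> edges G" "l \<in> e" for e
    proof -
      obtain r where "e = {l, r}"
        using graph_edgeE[OF g e(1)] e(2) by (metis insert_iff insert_commute singletonD)
      then show ?thesis using uniq[of q r] q e graph_edgeD[OF g] by metis
    qed
    have "edges G = insert {l, q} (edges G')"
    proof (intro equalityI subsetI)
      fix e assume "e \<in> edges G"
      then show "e \<in> insert {l, q} (edges G')" using lq by (cases "l \<in> e") (auto simp: G'_def)
    qed (use q in \<open>auto simp: G'_def\<close>)
    moreover have "q \<in> verts G'" using graph_edgeD[OF g q] by (auto simp: G'_def)
    ultimately show ?thesis using peelable.leaf[OF p V(2)] V(1) by simp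
  qed
qed

section \<open>Embeddings and the copies they produce\<close>

definition embedding :: "'a ugraph \<Rightarrow> 'b ugraph \<Rightarrow> ('a \<Rightarrow> 'b) \<Rightarrow> bool" where
  "embedding T G f \<longleftrightarrow> inj_on f (verts T) \<and> f ` verts T \<subseteq> verts G \<and>
     (\<forall>u v. {u, v} \<in> edges T \<longrightarrow> {f u, f v} \<in> edges G)"

text \<open>Only images of edges of \<open>T\<close> are kept, not all host edges among the image
  vertices, because copies need not be induced.\<close>

definition image_graph :: "('a \<Rightarrow> 'b) \<Rightarrow> 'a ugraph \<Rightarrow> 'b ugraph" where
  "image_graph f T = \<lparr>verts = f ` verts T, edges = (`) f ` edges T\<rparr>"

lemma subgraph_image_graph:
  assumes T: "graph T" and G: "graph G" and f: "embedding T G f"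
  shows "subgraph (image_graph f T) G"
proof -
  have inj: "inj_on f (verts T)" using f by (simp add: embedding_def)
  have sub: "edges (image_graph f T) \<subseteq> edges G"
  proof
    fix e assume "e \<in> edges (image_graph f T)"
    then obtain e' where e': "e' \<in> edges T" "e = f ` e'" by (auto simp: image_graph_def)
    obtain u v where "e' = {u, v}" using graph_edgeE[OF T e'(1)] .
    then show "e \<in> edges G" using e' f by (auto simp: embedding_def)
  qed
  have "edges (image_graph f T) \<subseteq> nsets (verts (image_graph f T)) 2"
  proof
    fix e assume "e \<in> edges (image_graph f T)"
    then obtain e' where e': "e' \<in> edges T" "e = f ` e'" by (auto simp: image_graph_def)
    obtain u v where "e' = {u, v}" "u \<noteq> v" "u \<in> verts T" "v \<in> verts T" using graph_edgeE[OF T e'(1)] .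
    then show "e \<in> nsets (verts (image_graph f T)) 2"
      using e' inj by (auto simp: image_graph_def nsets_def inj_on_def card_2_iff)
  qed
  then show ?thesis
    using sub f G T by (auto simp: subgraph_def graph_def embedding_def image_graph_def)
qed

lemma graph_iso_image_graph:
  assumes T: "graph T" and inj: "inj_on f (verts T)"
  shows "graph_iso (image_graph f T) T"
proof -
  let ?g = "the_inv_into (verts T) f"
  have g: "?g (f x) = x" if "x \<in> verts T" for x using that inj by (simp add: the_inv_into_f_f)
  have bij: "bij_betw ?g (f ` verts T) (verts T)"
    using inj by (simp add: bij_betw_the_inv_into inj_on_imp_bij_betw)
  have "{f x, f y} \<in> (`) f ` edges T \<longleftrightarrow> {x, y} \<in> edges T" if xy: "x \<in> verts T" "y \<in> verts T" for x y
  proof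
    assume "{f x, f y} \<in> (`) f ` edges T"
    then obtain e where e: "e \<in> edges T" "f ` e = f ` {x, y}" by auto
    then have "e \<subseteq> verts T" using T by (auto simp: graph_def nsets_def)
    then have "e = {x, y}" using e(2) inj xy by (metis empty_subsetI inj_on_image_eq_iff insert_subset)
    then show "{x, y} \<in> edges T" using e by simp
  next
    assume "{x, y} \<in> edges T"
    then have "f ` {x, y} \<in> (`) f ` edges T" by blast
    then show "{f x, f y} \<in> (`) f ` edges T" by simp
  qed
  then show ?thesis
    unfolding graph_iso_def using bij g by (intro exI[of _ ?g]) (auto simp: image_graph_def)
qed

text \<open>The embedding is the inverse of the isomorphism from \<open>H\<close> to
  \<open>T\<close>. Making it extensional leaves only finitely many maps into a finite host, so
  copies can be counted through embeddings.\<close>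

lemma copy_is_image_graph:
  assumes T: "graph T" and H: "subgraph H G" and iso: "graph_iso H T"
  obtains f where "f \<in> extensional (verts T)" "embedding T G f" "H = image_graph f T"
proof -
  obtain h where h: "bij_betw h (verts H) (verts T)"
    "\<And>u v. u \<in> verts H \<Longrightarrow> v \<in> verts H \<Longrightarrow> {u, v} \<in> edges H \<longleftrightarrow> {h u, h v} \<in> edges T"
    using iso by (auto simp: graph_iso_def)
  have gH: "graph H" using H by (simp add: subgraph_def)
  define f where "f = restrict (the_inv_into (verts H) h) (verts T)"
  have bij: "bij_betw f (verts T) (verts H)"
    using bij_betw_the_inv_into[OF h(1)] unfolding f_def by (metis bij_betw_restrict_eq)
  have hf: "h (f x) = x" if "x \<in> verts T" for x
    using that h(1) by (simp add: f_def f_the_inv_into_f_bij_betw)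
  have fh: "f (h x) = x" if "x \<in> verts H" for x
    using that h(1) bij_betwE[OF h(1)] by (simp add: f_def the_inv_into_f_f bij_betw_imp_inj_on)
  have fV: "f x \<in> verts H" if "x \<in> verts T" for x using that bij bij_betwE by fastforce
  have e1: "{f u, f v} \<in> edges H" if "{u, v} \<in> edges T" for u v
    using that graph_edgeD[OF T that] h(2)[of "f u" "f v"] hf fV by simp
  have "embedding T G f"
    using e1 bij H by (auto simp: embedding_def subgraph_def bij_betw_def)
  moreover have "edges H = (`) f ` edges T"
  proof (intro equalityI subsetI)
    fix e assume e: "e \<in> edges H"
    obtain u v where uv: "e = {u, v}" "u \<in> verts H" "v \<in> verts H" using graph_edgeE[OF gH e] .
    then have "{h u, h v} \<in> edges T" "f ` {h u, h v} = e" using h(2) e fh by auto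
    then show "e \<in> (`) f ` edges T" by blast
  next
    fix e assume "e \<in> (`) f ` edges T"
    then obtain e' where e': "e' \<in> edges T" "e = f ` e'" by auto
    obtain u v where "e' = {u, v}" using graph_edgeE[OF T e'(1)] .
    then show "e \<in> edges H" using e' e1 by auto
  qed
  then have "H = image_graph f T"
    using bij by (simp add: image_graph_def bij_betw_def)
  moreover have "f \<in> extensional (verts T)" by (simp add: f_def)
  ultimately show ?thesis by (intro that)
qed

lemma free_of_subgraph:
  assumes "free_of \<F> G" "subgraph H G"
  shows "free_of \<F> H"
  using assms unfolding free_of_def subgraph_def by (meson subset_trans)

lemma free_of_no_embedding:
  assumes "free_of \<F> G" "F \<in> \<F>" "graph F" "graph G"
  shows "\<not> embedding F G f"
  using assms subgraph_image_graph graph_iso_image_graph unfolding free_of_def embedding_def by metis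

section \<open>Excluding a forest forces degeneracy and a sparse orientation\<close>

text \<open>Greedy embedding along the construction order: fewer than \<open>m\<close> vertices are
  occupied when a new one is placed, while the image of its neighbour has at least \<open>m\<close>
  neighbours in \<open>W\<close>.\<close>

lemma forest_in_min_degree:
  assumes "peelable V E" "finite W" "W \<noteq> {}" "card V \<le> m"
    "\<And>w. w \<in> W \<Longrightarrow> m \<le> card {x \<in> W. {w, x} \<in> E'}" "\<And>w. {w} \<notin> E'"
  shows "\<exists>f. inj_on f V \<and> f ` V \<subseteq> W \<and> (\<forall>u v. {u, v} \<in> E \<longrightarrow> {f u, f v} \<in> E')"
  using assms
proof (induction rule: peelable.induct)
  case empty
  then show ?case by auto
next
  case (isolated V E l)
  have fV: "finite V" using peelable_finite isolated.hyps(1) .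
  then have cV: "card V < m" using isolated by simp
  then obtain f where f: "inj_on f V" "f ` V \<subseteq> W" "\<And>u v. {u, v} \<in> E \<Longrightarrow> {f u, f v} \<in> E'"
    using isolated less_imp_le by blast
  obtain w where w: "w \<in> W" using isolated by blast
  \<comment> \<open>There is no edge to follow here, but \<open>W\<close> contains a neighbourhood
    of size \<open>m\<close>, which leaves a free vertex.\<close>
  have "m \<le> card W"
    using isolated.prems(4)[OF w] card_mono[OF \<open>finite W\<close>, of "{x \<in> W. {w, x} \<in> E'}"] by auto
  then have "card (f ` V) < card W" using cV card_image_le[OF fV, of f] by linarith
  then obtain y where y: "y \<in> W" "y \<notin> f ` V"
    by (metis card_mono fV finite_imageI leD subsetI)
  have lE: "l \<notin> {u, v}" if "{u, v} \<in> E" for u v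
    using peelable_edge_subset[OF isolated.hyps(1) that] isolated.hyps(2) by blast
  show ?case
  proof (intro exI[of _ "f(l := y)"] conjI allI impI)
    show "inj_on (f(l := y)) (insert l V)"
      using f(1) y(2) isolated.hyps(2) by (auto simp: inj_on_def)
    show "(f(l := y)) ` insert l V \<subseteq> W" using f(2) y by auto
    fix u v assume "{u, v} \<in> E"
    then show "{(f(l := y)) u, (f(l := y)) v} \<in> E'" using lE f(3) by auto
  qed
next
  case (leaf V E l p)
  have fV: "finite V" using peelable_finite leaf.hyps(1) .
  then have cV: "card V < m" using leaf by simp
  then obtain f where f: "inj_on f V" "f ` V \<subseteq> W" "\<And>u v. {u, v} \<in> E \<Longrightarrow> {f u, f v} \<in> E'"
    using leaf less_imp_le by blast
  let ?N = "{x \<in> W. {f p, x} \<in> E'}"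
  have "m \<le> card ?N"
    using leaf.prems(4)[of "f p"] f(2) leaf.hyps(3) by blast
  then have "card (f ` V) < card ?N" using cV card_image_le[OF fV, of f] by linarith
  then obtain y where y: "y \<in> W" "{f p, y} \<in> E'" "y \<notin> f ` V"
    by (metis (no_types, lifting) card_mono fV finite_imageI leD subsetI mem_Collect_eq)
  have lE: "l \<notin> {u, v}" if "{u, v} \<in> E" for u v
    using peelable_edge_subset[OF leaf.hyps(1) that] leaf.hyps(2) by blast
  show ?case
  proof (intro exI[of _ "f(l := y)"] conjI allI impI)
    show "inj_on (f(l := y)) (insert l V)"
      using f(1) y(3) leaf.hyps(2) by (auto simp: inj_on_def)
    show "(f(l := y)) ` insert l V \<subseteq> W" using f(2) y by auto
    fix u v assume "{u, v} \<in> insert {l, p} E"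
    then consider "{u, v} = {l, p}" | "{u, v} \<in> E" by blast
    then show "{(f(l := y)) u, (f(l := y)) v} \<in> E'"
    proof cases
      case 1
      have "p \<noteq> l" using leaf.hyps by blast
      then show ?thesis using 1 y(2) by (auto simp: doubleton_eq_iff insert_commute)
    next
      case 2
      then show ?thesis using lE f(3) by auto
    qed
  qed
qed

text \<open>A vertex \<open>w\<close> of small degree is removed repeatedly, and its edges to the
  vertices still present are directed away from it. The out-degree of \<open>w\<close> is thus its
  degree at removal time.\<close>

lemma bounded_outdegree_orientation:
  assumes "finite W" and
    "\<And>W'. W' \<subseteq> W \<Longrightarrow> W' \<noteq> {} \<Longrightarrow> \<exists>w\<in>W'. card {x \<in> W'. {w, x} \<in> E} < m"
    and "\<And>w. {w} \<notin> E"
  shows "\<exists>D. D \<subseteq> {(x, y). x \<in> W \<and> y \<in> W \<and> {x, y} \<in> E} \<and>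
    (\<forall>x\<in>W. \<forall>y\<in>W. {x, y} \<in> E \<longrightarrow> (x, y) \<in> D \<or> (y, x) \<in> D) \<and> (\<forall>x. card (D `` {x}) \<le> m)"
  using assms(1,2)
proof (induction "card W" arbitrary: W)
  case 0
  then show ?case by (intro exI[of _ "{}"]) auto
next
  case (Suc n)
  then have "W \<noteq> {}" by auto
  then obtain w where w: "w \<in> W" "card {x \<in> W. {w, x} \<in> E} < m" using Suc.prems(2)[of W] by blast
  have "n = card (W - {w})" using Suc w by simp
  moreover have "finite (W - {w})" using Suc by simp
  moreover have "\<exists>w\<in>W'. card {x \<in> W'. {w, x} \<in> E} < m" if "W' \<subseteq> W - {w}" "W' \<noteq> {}" for W'
    using Suc.prems(2)[of W'] that by blast
  ultimately obtain D where D: "D \<subseteq> {(x, y). x \<in> W - {w} \<and> y \<in> W - {w} \<and> {x, y} \<in> E}"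
    "\<forall>x\<in>W - {w}. \<forall>y\<in>W - {w}. {x, y} \<in> E \<longrightarrow> (x, y) \<in> D \<or> (y, x) \<in> D" "\<forall>x. card (D `` {x}) \<le> m"
    using Suc.hyps(1)[of "W - {w}"] by blast
  define D' where "D' = D \<union> {w} \<times> {x \<in> W. {w, x} \<in> E}"
  have "card (D' `` {x}) \<le> m" for x
  proof (cases "x = w")
    case True
    then have "D' `` {x} = {x \<in> W. {w, x} \<in> E}" using D(1) by (auto simp: D'_def)
    then show ?thesis using w(2) by simp
  next
    case False
    then have "D' `` {x} = D `` {x}" by (auto simp: D'_def)
    then show ?thesis using D(3) by simp
  qed
  moreover have "D' \<subseteq> {(x, y). x \<in> W \<and> y \<in> W \<and> {x, y} \<in> E}" using D(1) w(1) by (auto simp: D'_def)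
  moreover have "(x, y) \<in> D' \<or> (y, x) \<in> D'" if "x \<in> W" "y \<in> W" "{x, y} \<in> E" for x y
    using that D(2) insert_commute[of x y "{}"] by (cases "x = w"; cases "y = w") (auto simp: D'_def)
  ultimately show ?case by (intro exI[of _ D']) blast
qed

text \<open>A nonempty vertex set in which every vertex has at least \<open>card (verts F)\<close>
  neighbours would contain \<open>F\<close>; hence every nonempty vertex set has a vertex of smaller
  degree within it, and the graph can be oriented.\<close>

lemma forest_free_orientation:
  assumes G: "graph G" and F: "forest F" "F \<in> \<F>" and free: "free_of \<F> G"
  shows "\<exists>D. (\<forall>x y. (x, y) \<in> D \<longrightarrow> {x, y} \<in> edges G) \<and>
    (\<forall>x y. {x, y} \<in> edges G \<longrightarrow> (x, y) \<in> D \<or> (y, x) \<in> D) \<and> (\<forall>x. card (D `` {x}) \<le> card (verts F))"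
proof -
  have gF: "graph F" using F by (simp add: forest_def)
  have fin: "finite (verts G)" using G by (simp add: graph_def)
  have sing: "{w} \<notin> edges G" for w using G by (auto simp: graph_def nsets_def)
  have "\<exists>w\<in>W'. card {x \<in> W'. {w, x} \<in> edges G} < card (verts F)" if W': "W' \<subseteq> verts G" "W' \<noteq> {}" for W'
  proof (rule ccontr)
    assume *: "\<not> ?thesis"
    have "\<exists>f. inj_on f (verts F) \<and> f ` verts F \<subseteq> W' \<and> (\<forall>u v. {u, v} \<in> edges F \<longrightarrow> {f u, f v} \<in> edges G)"
      using * W' sing finite_subset[OF W'(1) fin]
      by (intro forest_in_min_degree[OF forest_peelable[OF F(1)], where m = "card (verts F)"])
        (auto simp: not_less)
    then obtain f where "embedding F G f" using W' by (auto simp: embedding_def)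
    then show False using free_of_no_embedding[OF free F(2) gF G] by blast
  qed
  from bounded_outdegree_orientation[OF fin this sing]
  obtain D where D: "D \<subseteq> {(x, y). x \<in> verts G \<and> y \<in> verts G \<and> {x, y} \<in> edges G}"
    "\<forall>x\<in>verts G. \<forall>y\<in>verts G. {x, y} \<in> edges G \<longrightarrow> (x, y) \<in> D \<or> (y, x) \<in> D"
    "\<forall>x. card (D `` {x}) \<le> card (verts F)" by blast
  then show ?thesis using graph_edgeD[OF G] by (intro exI[of _ D]) blast
qed

section \<open>Connected sets and packing-covering duality in forests\<close>

text \<open>Connectivity by cuts is stable under deleting a leaf of the ambient forest.\<close>

definition conn :: "'a set set \<Rightarrow> 'a set \<Rightarrow> bool" where
  "conn E K \<longleftrightarrow> K \<noteq> {} \<and> (\<forall>A\<subset>K. A \<noteq> {} \<longrightarrow> (\<exists>a\<in>A. \<exists>b\<in>K - A. {a, b} \<in> E))"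

lemma conn_cut:
  assumes "conn E K" "A \<subset> K" "A \<noteq> {}"
  shows "\<exists>a\<in>A. \<exists>b\<in>K - A. {a, b} \<in> E"
  using assms unfolding conn_def by blast

lemma conn_mono:
  assumes "conn E K" "\<And>a b. a \<in> K \<Longrightarrow> b \<in> K \<Longrightarrow> {a, b} \<in> E \<Longrightarrow> {a, b} \<in> E'"
  shows "conn E' K"
  unfolding conn_def
proof (intro conjI allI impI)
  show "K \<noteq> {}" using assms(1) by (simp add: conn_def)
  fix A assume A: "A \<subset> K" "A \<noteq> {}"
  then obtain a b where "a \<in> A" "b \<in> K - A" "{a, b} \<in> E" using conn_cut[OF assms(1)] by blast
  then show "\<exists>a\<in>A. \<exists>b\<in>K - A. {a, b} \<in> E'" using assms(2) A by blast
qed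

text \<open>Take a smallest nonempty part of \<open>Y\<close> with no edge to the rest of
  \<open>Y\<close>; a cut inside it without crossing edge would split off a smaller such
  part.\<close>

lemma exists_component:
  assumes "finite Y" "Y \<noteq> {}"
  shows "\<exists>K\<subseteq>Y. conn E K \<and> (\<forall>a\<in>K. \<forall>b\<in>Y - K. {a, b} \<notin> E)"
proof -
  define P where "P K \<longleftrightarrow> K \<subseteq> Y \<and> K \<noteq> {} \<and> (\<forall>a\<in>K. \<forall>b\<in>Y - K. {a, b} \<notin> E)" for K
  have "P Y" using assms by (auto simp: P_def)
  then obtain K where K: "P K" and min: "\<And>L. P L \<Longrightarrow> card K \<le> card L"
    by (metis ex_has_least_nat)
  have "conn E K"
    unfolding conn_def
  proof (intro conjI allI impI)
    show "K \<noteq> {}" using K by (simp add: P_def)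
    fix A assume A: "A \<subset> K" "A \<noteq> {}"
    show "\<exists>a\<in>A. \<exists>b\<in>K - A. {a, b} \<in> E"
    proof (rule ccontr)
      assume "\<not> ?thesis"
      moreover have "Y - A = (Y - K) \<union> (K - A)" using A K by (auto simp: P_def)
      ultimately have "P A" using A K unfolding P_def by blast
      then have "card K \<le> card A" by (rule min)
      moreover have "finite K" using K assms finite_subset by (auto simp: P_def)
      ultimately show False using A psubset_card_mono by (metis leD)
    qed
  qed
  then show ?thesis using K by (auto simp: P_def)
qed

text \<open>Induction over the construction order. If the new vertex \<open>l\<close> alone is a
  member, \<open>l\<close> joins \<open>S\<close> and \<open>{l}\<close> joins the packing, and the
  induction hypothesis handles the members avoiding \<open>l\<close>. Otherwise \<open>l\<close> is
  cut off from every member, which costs neither connectivity nor disjointness.\<close>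

lemma subtrees_transversal:
  assumes "peelable V E" "\<And>K. K \<in> \<K> \<Longrightarrow> K \<subseteq> V \<and> conn E K"
  shows "\<exists>S \<D>. S \<subseteq> V \<and> \<D> \<subseteq> \<K> \<and> (\<forall>K\<in>\<K>. K \<inter> S \<noteq> {}) \<and> pairwise disjnt \<D> \<and> card S \<le> card \<D>"
  using assms
proof (induction arbitrary: \<K> rule: peelable.induct)
  case empty
  then have "\<K> = {}" by (auto simp: conn_def)
  then show ?case by (intro exI[of _ "{}"]) auto
next
  case (isolated V E l)
  have lE: "{l, b} \<notin> E" for b
    using peelable_edge_subset[OF isolated.hyps(1)] isolated.hyps(2) by blast
  \<comment> \<open>A connected set containing an isolated vertex is a singleton.\<close>
  have single: "K = {l}" if K: "K \<in> \<K>" "l \<in> K" for K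
  proof (rule ccontr)
    assume "K \<noteq> {l}"
    then have "{l} \<subset> K" using K by blast
    then have "\<exists>a\<in>{l}. \<exists>b\<in>K - {l}. {a, b} \<in> E"
      using isolated.prems[OF K(1)] by (intro conn_cut) auto
    then show False using lE by blast
  qed
  have "\<exists>S \<D>. S \<subseteq> V \<and> \<D> \<subseteq> \<K> - {{l}} \<and> (\<forall>K\<in>\<K> - {{l}}. K \<inter> S \<noteq> {}) \<and> pairwise disjnt \<D> \<and> card S \<le> card \<D>"
    using isolated.prems single by (intro isolated.IH) blast
  then obtain S \<D> where S: "S \<subseteq> V" "\<D> \<subseteq> \<K> - {{l}}" "\<forall>K\<in>\<K> - {{l}}. K \<inter> S \<noteq> {}"
    "pairwise disjnt \<D>" "card S \<le> card \<D>" by blast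
  show ?case
  proof (cases "{l} \<in> \<K>")
    case False
    then show ?thesis using S by (intro exI[of _ S] exI[of _ \<D>]) auto
  next
    case True
    have fV: "finite V" using peelable_finite isolated.hyps(1) .
    have "\<Union>\<D> \<subseteq> insert l V" using S(2) isolated.prems by blast
    then have fD: "finite \<D>" using fV by (meson finite.insertI finite_UnionD finite_subset)
    have "pairwise disjnt (insert {l} \<D>)"
      using S(2,4) single by (auto simp: pairwise_insert disjnt_def)
    moreover have "card (insert l S) \<le> card (insert {l} \<D>)"
      using S(1,2,5) fD fV isolated.hyps(2) by (subst (1 2) card_insert_disjoint) (auto intro: finite_subset)
    ultimately show ?thesis using S True
      by (intro exI[of _ "insert l S"] exI[of _ "insert {l} \<D>"]) auto
  qed
next
  case (leaf V E l p)
  have fV: "finite V" using peelable_finite leaf.hyps(1) .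
  have lp: "l \<noteq> p" using leaf.hyps by blast
  have lE: "{l, b} \<notin> E" "{b, l} \<notin> E" for b
    using peelable_edge_subset[OF leaf.hyps(1)] leaf.hyps(2) by blast+
  have conn0: "K \<subseteq> V \<and> conn E K" if K: "K \<in> \<K>" "l \<notin> K" for K
  proof -
    have "K \<subseteq> insert l V" "conn (insert {l, p} E) K" using leaf.prems[OF K(1)] by auto
    moreover have "{a, b} \<in> E" if "a \<in> K" "b \<in> K" "{a, b} \<in> insert {l, p} E" for a b
      using that K(2) by (auto simp: doubleton_eq_iff)
    ultimately show ?thesis using K(2) conn_mono by blast
  qed
  show ?case
  proof (cases "{l} \<in> \<K>")
    case True
    let ?K = "{K \<in> \<K>. l \<notin> K}"
    have "\<exists>S \<D>. S \<subseteq> V \<and> \<D> \<subseteq> ?K \<and> (\<forall>K\<in>?K. K \<inter> S \<noteq> {}) \<and> pairwise disjnt \<D> \<and> card S \<le> card \<D>"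
      using conn0 by (intro leaf.IH) blast
    then obtain S \<D> where S: "S \<subseteq> V" "\<D> \<subseteq> ?K" "\<forall>K\<in>?K. K \<inter> S \<noteq> {}"
      "pairwise disjnt \<D>" "card S \<le> card \<D>" by blast
    have "\<Union>\<D> \<subseteq> insert l V" using S(2) leaf.prems by blast
    then have fD: "finite \<D>" using fV by (meson finite.insertI finite_UnionD finite_subset)
    have "pairwise disjnt (insert {l} \<D>)"
      using S(2,4) by (auto simp: pairwise_insert disjnt_def)
    moreover have "card (insert l S) \<le> card (insert {l} \<D>)"
      using S(1,2,5) fD fV leaf.hyps(2) by (subst (1 2) card_insert_disjoint) (auto intro: finite_subset)
    ultimately show ?thesis using S True
      by (intro exI[of _ "insert l S"] exI[of _ "insert {l} \<D>"]) auto
  next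
    case False
    \<comment> \<open>Two members containing the leaf \<open>l\<close> also share \<open>p\<close>, so deleting \<open>l\<close> preserves disjointness.\<close>
    have pK: "p \<in> K" if K: "K \<in> \<K>" "l \<in> K" for K
    proof -
      have "{l} \<subset> K" using K False by blast
      then have "\<exists>a\<in>{l}. \<exists>b\<in>K - {l}. {a, b} \<in> insert {l, p} E"
        using leaf.prems[OF K(1)] by (intro conn_cut) auto
      then obtain b where "b \<in> K" "{l, b} \<in> insert {l, p} E" by blast
      then show ?thesis using lE by (auto simp: doubleton_eq_iff)
    qed
    have conn1: "K - {l} \<subseteq> V \<and> conn E (K - {l})" if K: "K \<in> \<K>" for K
    proof (cases "l \<in> K")
      case False
      then show ?thesis using conn0[OF K] by simp
    next
      case True
      have c: "\<exists>a\<in>A. \<exists>b\<in>K - A. {a, b} \<in> insert {l, p} E" if "A \<subset> K" "A \<noteq> {}" for A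
        using leaf.prems[OF K] that by (intro conn_cut) auto
      have "conn E (K - {l})"
        unfolding conn_def
      proof (intro conjI allI impI)
        show "K - {l} \<noteq> {}" using pK[OF K True] lp by blast
        fix A assume A: "A \<subset> K - {l}" "A \<noteq> {}"
        show "\<exists>a\<in>A. \<exists>b\<in>K - {l} - A. {a, b} \<in> E"
        proof (cases "p \<in> A")
          case pA: True
          \<comment> \<open>With \<open>p\<close> in \<open>A\<close>, moving \<open>l\<close> to
            the same side ensures that the crossing edge is not the leaf edge \<open>{l, p}\<close>
            and so lies in \<open>E\<close>.\<close>
          have "insert l A \<subset> K" using A True by blast
          then obtain a b where "a \<in> insert l A" "b \<in> K - insert l A" "{a, b} \<in> insert {l, p} E"
            using c[of "insert l A"] by blast
          then show ?thesis using pA lE A by (intro bexI[of _ a] bexI[of _ b]) (auto simp: doubleton_eq_iff)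
        next
          case pA: False
          have "A \<subset> K" using A True by blast
          then obtain a b where "a \<in> A" "b \<in> K - A" "{a, b} \<in> insert {l, p} E"
            using c[of "A"] A by blast
          then show ?thesis using pA lE A by (intro bexI[of _ a] bexI[of _ b]) (auto simp: doubleton_eq_iff)
        qed
      qed
      then show ?thesis using leaf.prems[OF K] by blast
    qed
    let ?K = "(\<lambda>K. K - {l}) ` \<K>"
    have "\<exists>S \<D>. S \<subseteq> V \<and> \<D> \<subseteq> ?K \<and> (\<forall>K\<in>?K. K \<inter> S \<noteq> {}) \<and> pairwise disjnt \<D> \<and> card S \<le> card \<D>"
      using conn1 by (intro leaf.IH) blast
    then obtain S \<D> where S: "S \<subseteq> V" "\<D> \<subseteq> ?K" "\<forall>K\<in>?K. K \<inter> S \<noteq> {}"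
      "pairwise disjnt \<D>" "card S \<le> card \<D>" by (elim exE conjE)
    \<comment> \<open>Each packed set is lifted to an original member that yields it after deletion
      of \<open>l\<close>; since the trimmed set can be recovered from its lift, \<open>c\<close> is
      injective.\<close>
    have "\<forall>K'\<in>\<D>. \<exists>K\<in>\<K>. K - {l} = K'" using S(2) by blast
    then obtain c where c: "\<And>K'. K' \<in> \<D> \<Longrightarrow> c K' \<in> \<K> \<and> c K' - {l} = K'" by metis
    have "inj_on c \<D>" by (metis c inj_onI)
    then have "card (c ` \<D>) = card \<D>" by (rule card_image)
    moreover have "pairwise disjnt (c ` \<D>)"
    proof (rule pairwise_imageI)
      fix X Y assume XY: "X \<in> \<D>" "Y \<in> \<D>" "X \<noteq> Y"
      have d: "X \<inter> Y = {}" using S(4) XY by (auto simp: pairwise_def disjnt_def)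
      show "disjnt (c X) (c Y)"
      proof (cases "l \<in> c X \<and> l \<in> c Y")
        case True
        then have "p \<in> X \<inter> Y" using pK c XY lp by blast
        then show ?thesis using d by blast
      next
        case False
        then show ?thesis using c[OF XY(1)] c[OF XY(2)] d by (auto simp: disjnt_def)
      qed
    qed
    moreover have "K \<inter> S \<noteq> {}" if "K \<in> \<K>" for K
      using bspec[OF S(3), of "K - {l}"] that by auto
    moreover have "c ` \<D> \<subseteq> \<K>" using c by blast
    moreover have "S \<subseteq> insert l V" using S(1) by blast
    ultimately show ?thesis using S(5)
      by (intro exI[of _ S] exI[of _ "c ` \<D>"]) simp
  qed
qed

section \<open>Flexible sets and counting embeddings without them\<close>

text \<open>Greedy choice: either some member avoids all sets picked so far and extends the family,
  or the union of the picked sets meets every member.\<close>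

lemma disjoint_family_or_hitting_set:
  assumes "\<And>X. X \<in> \<X> \<Longrightarrow> finite X \<and> card X \<le> m"
  shows "(\<exists>g. (\<forall>i<s. g i \<in> \<X>) \<and> (\<forall>i<s. \<forall>j<i. g i \<inter> g j = {})) \<or>
    (\<exists>B. finite B \<and> card B \<le> s * m \<and> (\<forall>X\<in>\<X>. X \<inter> B \<noteq> {}))"
proof (induction s)
  case 0
  then show ?case by simp
next
  case (Suc s)
  then consider (disj) g where "\<forall>i<s. g i \<in> \<X>" "\<forall>i<s. \<forall>j<i. g i \<inter> g j = {}"
    | (hit) B where "finite B" "card B \<le> s * m" "\<forall>X\<in>\<X>. X \<inter> B \<noteq> {}" by blast
  then show ?case
  proof cases
    case hit
    then have "card B \<le> Suc s * m" by simp
    then show ?thesis using hit by blast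
  next
    case disj
    let ?B = "\<Union>i<s. g i"
    show ?thesis
    proof (cases "\<forall>X\<in>\<X>. X \<inter> ?B \<noteq> {}")
      case True
      have "card ?B \<le> (\<Sum>i<s. card (g i))" by (rule card_UN_le) simp
      also have "\<dots> \<le> s * m" using sum_bounded_above[of "{..<s}" "\<lambda>i. card (g i)" m] disj(1) assms by simp
      finally have "card ?B \<le> Suc s * m" by simp
      moreover have "finite ?B" using disj(1) assms by blast
      ultimately show ?thesis using True by blast
    next
      case False
      then obtain X where X: "X \<in> \<X>" "\<And>i. i < s \<Longrightarrow> X \<inter> g i = {}" by blast
      let ?g = "g(s := X)"
      have "\<forall>i<Suc s. ?g i \<in> \<X>" using X disj(1) by (auto simp: less_Suc_eq)
      moreover have "\<forall>i<Suc s. \<forall>j<i. ?g i \<inter> ?g j = {}" using X disj(2) by (auto simp: less_Suc_eq)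
      ultimately show ?thesis by blast
    qed
  qed
qed

definition reembeds :: "('a \<times> 'a) set \<Rightarrow> ('b \<times> 'b) set \<Rightarrow> 'b set \<Rightarrow> 'a set \<Rightarrow> ('a \<Rightarrow> 'b) \<Rightarrow> ('a \<Rightarrow> 'b) \<Rightarrow> bool" where
  "reembeds A D W K f g \<longleftrightarrow> inj_on g K \<and> g ` K \<subseteq> W \<and>
     (\<forall>a b. (a, b) \<in> A \<longrightarrow> a \<in> K \<or> b \<in> K \<longrightarrow> (override_on f g K a, override_on f g K b) \<in> D)"

definition flexible :: "('a \<times> 'a) set \<Rightarrow> ('b \<times> 'b) set \<Rightarrow> 'b set \<Rightarrow> nat \<Rightarrow> ('a \<Rightarrow> 'b) \<Rightarrow> 'a set \<Rightarrow> bool" where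
  "flexible A D W s f K \<longleftrightarrow> (\<exists>g. (\<forall>i<s. reembeds A D W K f (g i)) \<and>
     (\<forall>i<s. \<forall>j<i. g i ` K \<inter> g j ` K = {}))"

text \<open>The greedy dichotomy applied to the images of \<open>K\<close>. Non-flexibility is used
  in this form: some vertex of \<open>K\<close> must always land in one bounded set.\<close>

lemma not_flexible_hitting_set:
  assumes "finite K" "\<not> flexible A D W s f K"
  shows "\<exists>B. finite B \<and> card B \<le> s * card K \<and> (\<forall>g. reembeds A D W K f g \<longrightarrow> g ` K \<inter> B \<noteq> {})"
proof -
  let ?X = "(\<lambda>g. g ` K) ` Collect (reembeds A D W K f)"
  have "\<nexists>h. (\<forall>i<s. h i \<in> ?X) \<and> (\<forall>i<s. \<forall>j<i. h i \<inter> h j = {})"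
  proof
    assume "\<exists>h. (\<forall>i<s. h i \<in> ?X) \<and> (\<forall>i<s. \<forall>j<i. h i \<inter> h j = {})"
    then obtain h where h: "\<forall>i<s. h i \<in> ?X" "\<forall>i<s. \<forall>j<i. h i \<inter> h j = {}" by (elim exE conjE)
    have "\<forall>i<s. \<exists>g. h i = g ` K \<and> reembeds A D W K f g" using h(1) by fast
    then obtain g where g: "\<And>i. i < s \<Longrightarrow> h i = g i ` K \<and> reembeds A D W K f (g i)" by metis
    have "g i ` K \<inter> g j ` K = {}" if "i < s" "j < i" for i j
      using h(2) that g[of i] g[of j] by (metis order.strict_trans)
    then have "flexible A D W s f K" unfolding flexible_def using g by blast
    then show False using assms by blast
  qed
  moreover have "finite X \<and> card X \<le> card K" if "X \<in> ?X" for X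
    using that assms(1) by (auto simp: card_image_le)
  ultimately have "\<exists>B. finite B \<and> card B \<le> s * card K \<and> (\<forall>X\<in>?X. X \<inter> B \<noteq> {})"
    using disjoint_family_or_hitting_set[of ?X "card K" s] by (simp only: simp_thms)
  then show ?thesis by simp
qed

text \<open>Induction on the number of vertices outside \<open>X\<close>. A component
  \<open>K\<close> of the remainder is not flexible, so some vertex of \<open>K\<close> maps into a
  bounded set. Guessing that vertex and its image costs a factor
  \<open>card V * (s * card V)\<close> and fixes one more vertex.\<close>

lemma card_extensions_le:
  assumes V: "finite V" and A: "A \<subseteq> V \<times> V" "\<And>a b. (a, b) \<in> A \<Longrightarrow> {a, b} \<in> E"
    and F: "\<And>f. f \<in> \<Phi> \<Longrightarrow> f \<in> extensional V \<and> inj_on f V \<and> f ` V \<subseteq> W \<and> (\<forall>(a, b)\<in>A. (f a, f b) \<in> D)"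
    and nonflex: "\<And>f K. f \<in> \<Phi> \<Longrightarrow> K \<subseteq> V - S \<Longrightarrow> conn E K \<Longrightarrow> \<not> flexible A D W s f K"
    and X: "S \<subseteq> X" "X \<subseteq> V"
  shows "finite {f \<in> \<Phi>. \<forall>x\<in>X. f x = h x} \<and>
    card {f \<in> \<Phi>. \<forall>x\<in>X. f x = h x} \<le> (card V * (s * card V)) ^ card (V - X)"
  using X
proof (induction "card (V - X)" arbitrary: X h)
  case 0
  then have "X = V" using V by auto
  then have eq: "f = g" if "f \<in> {f \<in> \<Phi>. \<forall>x\<in>X. f x = h x}" "g \<in> {f \<in> \<Phi>. \<forall>x\<in>X. f x = h x}" for f g
    using that F by (intro extensionalityI[of f V g]) auto
  obtain g where g: "{f \<in> \<Phi>. \<forall>x\<in>X. f x = h x} \<subseteq> {g}"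
    using eq by (metis (no_types, lifting) empty_subsetI subsetI singletonI ex_in_conv)
  then have "finite {f \<in> \<Phi>. \<forall>x\<in>X. f x = h x} \<and> card {f \<in> \<Phi>. \<forall>x\<in>X. f x = h x} \<le> 1"
    using finite_subset[OF g] card_mono[OF _ g] by simp
  then show ?case using 0(1)[symmetric] by simp
next
  case (Suc n)
  let ?P = "\<lambda>X h. {f \<in> \<Phi>. \<forall>x\<in>X. f x = h x}"
  let ?M = "card V * (s * card V)"
  show ?case
  proof (cases "?P X h = {}")
    case True
    then show ?thesis by (simp only: finite.emptyI card.empty le0 simp_thms)
  next
    case False
    \<comment> \<open>Any one extension serves as the reference map for flexibility of
      \<open>K\<close>.\<close>
    then obtain f0 where f0: "f0 \<in> \<Phi>" "\<And>x. x \<in> X \<Longrightarrow> f0 x = h x" by blast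
    have fY: "finite (V - X)" "V - X \<noteq> {}"
      using V Suc.hyps(2) by (simp, metis card.empty nat.distinct(1))
    obtain K where K: "K \<subseteq> V - X" "conn E K" "\<And>a b. a \<in> K \<Longrightarrow> b \<in> V - X - K \<Longrightarrow> {a, b} \<notin> E"
      using exists_component[OF fY, of E] by blast
    have fK: "finite K" "card K \<le> card V" using K(1) V by (auto intro: finite_subset card_mono)
    have "\<not> flexible A D W s f0 K" using nonflex f0(1) K Suc.prems by blast
    from not_flexible_hitting_set[OF fK(1) this]
    obtain B where B: "finite B" "card B \<le> s * card K" "\<And>g. reembeds A D W K f0 g \<Longrightarrow> g ` K \<inter> B \<noteq> {}"
      by blast
    \<comment> \<open>All neighbours of \<open>K\<close> lie in \<open>X\<close>, so one hitting set serves every extension of \<open>h\<close>.\<close>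
    have reemb: "reembeds A D W K f0 f" if f: "f \<in> ?P X h" for f
    proof -
      have "override_on f0 f K a = f a" if "a \<in> K \<union> X" for a
        using that f f0 by (auto simp: override_on_def)
      moreover have "a \<in> K \<union> X \<and> b \<in> K \<union> X" if ab: "(a, b) \<in> A" "a \<in> K \<or> b \<in> K" for a b
        using K(3)[of a b] K(3)[of b a] A(1) A(2)[OF ab(1)] ab K(1) by (auto simp: insert_commute)
      moreover have "inj_on f K" "f ` K \<subseteq> W" using F[of f] f K(1) by (auto intro: inj_on_subset)
      ultimately show ?thesis using F[of f] f by (fastforce simp: reembeds_def)
    qed
    have IH: "finite (?P (insert v X) h') \<and> card (?P (insert v X) h') \<le> ?M ^ n" if "v \<in> K" for v h'
    proof -
      have v: "v \<in> V - X" using that K(1) by blast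
      have "V - insert v X = (V - X) - {v}" by blast
      then have n: "n = card (V - insert v X)" using Suc.hyps(2) v V by simp
      show ?thesis using Suc.hyps(1)[OF n _ _, of h'] Suc.prems v unfolding n by blast
    qed
    \<comment> \<open>\<open>Q (v, y)\<close> consists of the extensions that also send
      \<open>v\<close> to \<open>y\<close>.\<close>
    define Q where "Q p = ?P (insert (fst p) X) (h(fst p := snd p))" for p
    have Q: "finite (Q p) \<and> card (Q p) \<le> ?M ^ n" if "p \<in> K \<times> B" for p
      using that IH[of "fst p"] by (auto simp only: Q_def mem_Times_iff)
    have sub: "?P X h \<subseteq> (\<Union>p\<in>K \<times> B. Q p)"
    proof
      fix f assume f: "f \<in> ?P X h"
      obtain v where v: "v \<in> K" "f v \<in> B" using B(3)[OF reemb[OF f]] by blast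
      have "f \<in> Q (v, f v)" using f v K(1) by (auto simp: Q_def)
      then show "f \<in> (\<Union>p\<in>K \<times> B. Q p)" using v by blast
    qed
    have fin: "finite (\<Union>p\<in>K \<times> B. Q p)"
      using Q fK(1) B(1) by (intro finite_UN_I finite_cartesian_product) auto
    have "card (?P X h) \<le> card (\<Union>p\<in>K \<times> B. Q p)"
      using sub fin by (intro card_mono)
    also have "\<dots> \<le> (\<Sum>p\<in>K \<times> B. card (Q p))"
      using fK(1) B(1) by (intro card_UN_le) simp
    also have "\<dots> \<le> of_nat (card (K \<times> B)) * ?M ^ n"
      using Q by (intro sum_bounded_above) blast
    also have "of_nat (card (K \<times> B)) * ?M ^ n \<le> ?M * ?M ^ n"
    proof -
      have "card B \<le> s * card V" using B(2) fK(2) by (meson mult_le_mono2 order_trans)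
      then have "card (K \<times> B) \<le> ?M" using fK(2) by (simp only: card_cartesian_product mult_le_mono)
      then show ?thesis by simp
    qed
    finally have "card (?P X h) \<le> ?M * ?M ^ n" by simp
    moreover have "finite (?P X h)" using sub fin by (rule finite_subset)
    ultimately show ?thesis unfolding Suc.hyps(2)[symmetric] by simp
  qed
qed

text \<open>Maps are sorted by their restriction to \<open>S\<close>, for which there are
  \<open>card W ^ card S\<close> possibilities; each restriction has boundedly many
  extensions.\<close>

lemma card_embeddings_le:
  assumes V: "finite V" and A: "A \<subseteq> V \<times> V" "\<And>a b. (a, b) \<in> A \<Longrightarrow> {a, b} \<in> E"
    and F: "\<And>f. f \<in> \<Phi> \<Longrightarrow> f \<in> extensional V \<and> inj_on f V \<and> f ` V \<subseteq> W \<and> (\<forall>(a, b)\<in>A. (f a, f b) \<in> D)"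
    and nonflex: "\<And>f K. f \<in> \<Phi> \<Longrightarrow> K \<subseteq> V - S \<Longrightarrow> conn E K \<Longrightarrow> \<not> flexible A D W s f K"
    and S: "S \<subseteq> V" and W: "finite W"
  shows "card \<Phi> \<le> card W ^ card S * Suc (card V * (s * card V)) ^ card V"
proof -
  let ?M = "card V * (s * card V)"
  let ?P = "\<lambda>h. {f \<in> \<Phi>. \<forall>x\<in>S. f x = h x}"
  have P: "finite (?P h) \<and> card (?P h) \<le> ?M ^ card (V - S)" for h
    by (rule card_extensions_le[OF V A _ nonflex order_refl S]) (use F in auto)
  \<comment> \<open>\<open>Suc\<close> makes the base at least one, so the exponent can be raised to
    \<open>card V\<close>, independently of \<open>S\<close>.\<close>
  have "?M ^ card (V - S) \<le> Suc ?M ^ card (V - S)" by (intro power_mono) auto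
  also have "\<dots> \<le> Suc ?M ^ card V" using V by (intro power_increasing card_mono) auto
  finally have P': "finite (?P h) \<and> card (?P h) \<le> Suc ?M ^ card V" for h
    using P[of h] by linarith
  have fS: "finite S" using S V finite_subset by blast
  have fin: "finite (S \<rightarrow>\<^sub>E W)" using fS W by (simp add: finite_PiE)
  have sub: "\<Phi> \<subseteq> (\<Union>h\<in>S \<rightarrow>\<^sub>E W. ?P h)"
  proof
    fix f assume f: "f \<in> \<Phi>"
    have "restrict f S \<in> S \<rightarrow>\<^sub>E W" using F[OF f] S by auto
    moreover have "f \<in> ?P (restrict f S)" using f by simp
    ultimately show "f \<in> (\<Union>h\<in>S \<rightarrow>\<^sub>E W. ?P h)" by blast
  qed
  have "card \<Phi> \<le> card (\<Union>h\<in>S \<rightarrow>\<^sub>E W. ?P h)"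
    using P' fin sub by (intro card_mono) auto
  also have "\<dots> \<le> (\<Sum>h\<in>S \<rightarrow>\<^sub>E W. card (?P h))" using fin by (rule card_UN_le)
  also have "\<dots> \<le> of_nat (card (S \<rightarrow>\<^sub>E W)) * Suc ?M ^ card V"
    using P' by (intro sum_bounded_above) auto
  also have "card (S \<rightarrow>\<^sub>E W) = card W ^ card S" using fS by (simp add: card_PiE)
  finally show ?thesis by simp
qed

section \<open>Blow-ups from disjoint flexible sets\<close>

text \<open>When an index is treated, \<open>B\<close> and the earlier choices together have fewer
  than \<open>s\<close> elements, so they cannot meet all of its \<open>s\<close> pairwise disjoint
  options.\<close>

lemma disjoint_representatives:
  assumes "finite I" "finite B" "card B + m * card I < s"
    and "\<And>x i. x \<in> I \<Longrightarrow> i < s \<Longrightarrow> finite (opt x i) \<and> card (opt x i) \<le> m"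
    and "\<And>x i j. x \<in> I \<Longrightarrow> i < s \<Longrightarrow> j < i \<Longrightarrow> opt x i \<inter> opt x j = {}"
  shows "\<exists>\<sigma>. (\<forall>x\<in>I. \<sigma> x < s \<and> opt x (\<sigma> x) \<inter> B = {}) \<and>
    (\<forall>x\<in>I. \<forall>y\<in>I. x \<noteq> y \<longrightarrow> opt x (\<sigma> x) \<inter> opt y (\<sigma> y) = {})"
  using assms
proof (induction I rule: finite_induct)
  case empty
  then show ?case by simp
next
  case (insert x I)
  have lt: "card B + m * card I < s" and lt': "card B + m * card I + m < s"
    using insert.prems(2) insert.hyps by simp_all
  have "\<exists>\<sigma>. (\<forall>x\<in>I. \<sigma> x < s \<and> opt x (\<sigma> x) \<inter> B = {}) \<and>
    (\<forall>x\<in>I. \<forall>y\<in>I. x \<noteq> y \<longrightarrow> opt x (\<sigma> x) \<inter> opt y (\<sigma> y) = {})"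
    using insert.prems lt by (intro insert.IH) auto
  then obtain \<sigma> where \<sigma>: "\<And>x. x \<in> I \<Longrightarrow> \<sigma> x < s \<and> opt x (\<sigma> x) \<inter> B = {}"
    "\<And>x y. x \<in> I \<Longrightarrow> y \<in> I \<Longrightarrow> x \<noteq> y \<Longrightarrow> opt x (\<sigma> x) \<inter> opt y (\<sigma> y) = {}" by blast
  let ?U = "\<Union>y\<in>I. opt y (\<sigma> y)"
  have "card ?U \<le> (\<Sum>y\<in>I. card (opt y (\<sigma> y)))" using insert.hyps by (intro card_UN_le)
  also have "\<dots> \<le> of_nat (card I) * m"
    using insert.prems(3) \<sigma>(1) by (intro sum_bounded_above) auto
  finally have "card (B \<union> ?U) < s" using lt card_Un_le[of B ?U] by (simp add: mult.commute)
  moreover have fin: "finite (B \<union> ?U)" using insert.prems(1,3) insert.hyps \<sigma>(1) by auto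
  moreover have "\<exists>i<s. opt x i \<inter> (B \<union> ?U) = {}"
  proof (rule ccontr)
    assume "\<not> ?thesis"
    \<comment> \<open>Picking from each option a point of the forbidden set would inject
      \<open>{..<s}\<close> into it.\<close>
    then have "\<forall>i<s. \<exists>y. y \<in> opt x i \<and> y \<in> B \<union> ?U" by blast
    then obtain y where y: "\<And>i. i < s \<Longrightarrow> y i \<in> opt x i \<and> y i \<in> B \<union> ?U" by metis
    have "inj_on y {..<s}"
    proof (rule linorder_inj_onI')
      fix i j assume ij: "i \<in> {..<s}" "j \<in> {..<s}" "i < j"
      then have "opt x j \<inter> opt x i = {}" using insert.prems(4) by simp
      then show "y i \<noteq> y j" using y[of i] y[of j] ij by auto
    qed
    then have "s \<le> card (B \<union> ?U)" using y fin card_inj_on_le[of y "{..<s}" "B \<union> ?U"] by auto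
    then show False using calculation by simp
  qed
  then obtain i where i: "i < s" "opt x i \<inter> (B \<union> ?U) = {}" by blast
  have i': "opt x i \<inter> opt y (\<sigma> y) = {}" if "y \<in> I" for y using i(2) that by blast
  show ?case
    using i i' \<sigma> insert.hyps(2) by (intro exI[of _ "\<sigma>(x := i)"]) (auto simp: Int_commute)
qed

text \<open>Without edges between members, the members can be cloned independently; nonemptiness
  allows one representative to be taken from each.\<close>

definition scattered :: "'a ugraph \<Rightarrow> 'a set set \<Rightarrow> bool" where
  "scattered T \<D> \<longleftrightarrow> \<D> \<subseteq> Pow (verts T) - {{}} \<and> pairwise disjnt \<D> \<and>
     (\<forall>K\<in>\<D>. \<forall>L\<in>\<D>. K \<noteq> L \<longrightarrow> (\<forall>a\<in>K. \<forall>b\<in>L. {a, b} \<notin> edges T))"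

text \<open>
  \<open>\<phi> v i\<close> is the \<open>i\<close>-th clone of \<open>v\<close>; only the vertices in \<open>\<Union>\<D>\<close> are really cloned. Because distinct
  members of a scattered \<open>\<D>\<close> are not adjacent, joining clones of equal index describes all edges.
\<close>

definition contains_blowup :: "'a ugraph \<Rightarrow> 'a set set \<Rightarrow> nat \<Rightarrow> 'b ugraph \<Rightarrow> bool" where
  "contains_blowup T \<D> t G \<longleftrightarrow> (\<exists>\<phi>.
     (\<forall>v\<in>verts T. \<forall>i<t. \<phi> v i \<in> verts G) \<and>
     (\<forall>u\<in>verts T. \<forall>v\<in>verts T. \<forall>i<t. \<forall>j<t. \<phi> u i = \<phi> v j \<longrightarrow> u = v \<and> (u \<in> \<Union>\<D> \<longrightarrow> i = j)) \<and>
     (\<forall>v\<in>verts T - \<Union>\<D>. \<forall>i. \<phi> v i = \<phi> v 0) \<and>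
     (\<forall>u v. {u, v} \<in> edges T \<longrightarrow> (\<forall>i<t. {\<phi> u i, \<phi> v i} \<in> edges G)))"

lemma contains_blowup_mono:
  assumes "contains_blowup T \<D> t G" "t' \<le> t"
  shows "contains_blowup T \<D> t' G"
proof -
  obtain \<phi> where \<phi>: "\<forall>v\<in>verts T. \<forall>i<t. \<phi> v i \<in> verts G"
     "\<forall>u\<in>verts T. \<forall>v\<in>verts T. \<forall>i<t. \<forall>j<t. \<phi> u i = \<phi> v j \<longrightarrow> u = v \<and> (u \<in> \<Union>\<D> \<longrightarrow> i = j)"
     "\<forall>v\<in>verts T - \<Union>\<D>. \<forall>i. \<phi> v i = \<phi> v 0"
     "\<forall>u v. {u, v} \<in> edges T \<longrightarrow> (\<forall>i<t. {\<phi> u i, \<phi> v i} \<in> edges G)"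
    using assms(1) unfolding contains_blowup_def by (elim exE conjE)
  have lt: "i < t" if "i < t'" for i using that assms(2) by simp
  show ?thesis
    unfolding contains_blowup_def
  proof (intro exI[of _ \<phi>] conjI)
    show "\<forall>v\<in>verts T. \<forall>i<t'. \<phi> v i \<in> verts G" using \<phi>(1) lt by blast
    show "\<forall>u\<in>verts T. \<forall>v\<in>verts T. \<forall>i<t'. \<forall>j<t'. \<phi> u i = \<phi> v j \<longrightarrow> u = v \<and> (u \<in> \<Union>\<D> \<longrightarrow> i = j)"
      using \<phi>(2) lt by metis
    show "\<forall>u v. {u, v} \<in> edges T \<longrightarrow> (\<forall>i<t'. {\<phi> u i, \<phi> v i} \<in> edges G)" using \<phi>(4) lt by metis
  qed (rule \<phi>(3))
qed

text \<open>One vertex from each member: these are distinct by disjointness and pairwise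
  non-adjacent.\<close>

lemma scattered_card_le_independence_number:
  assumes T: "graph T" and D: "scattered T \<D>"
  shows "card \<D> \<le> independence_number T"
proof -
  have "\<forall>K\<in>\<D>. \<exists>v. v \<in> K" using D by (auto simp: scattered_def)
  then obtain r where r: "\<And>K. K \<in> \<D> \<Longrightarrow> r K \<in> K" by metis
  have inj: "inj_on r \<D>"
  proof (rule inj_onI, rule ccontr)
    fix K L assume KL: "K \<in> \<D>" "L \<in> \<D>" "r K = r L" "K \<noteq> L"
    then have "K \<inter> L = {}" using D by (auto simp: scattered_def pairwise_def disjnt_def)
    then show False using r[OF KL(1)] r[OF KL(2)] KL(3) by auto
  qed
  have "{r K, r L} \<notin> edges T" if "K \<in> \<D>" "L \<in> \<D>" "r K \<noteq> r L" for K L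
    using that D r by (metis scattered_def)
  then have "indep (r ` \<D>) (edges T)" by (auto simp: indep_def)
  moreover have "r ` \<D> \<subseteq> verts T" using D r by (auto simp: scattered_def)
  ultimately have mem: "card (r ` \<D>) \<in> {card S |S. S \<subseteq> verts T \<and> indep S (edges T)}" by blast
  have "{card S |S. S \<subseteq> verts T \<and> indep S (edges T)} \<subseteq> card ` Pow (verts T)" by blast
  moreover have "finite (card ` Pow (verts T))" using T by (simp add: graph_def)
  ultimately have "finite {card S |S. S \<subseteq> verts T \<and> indep S (edges T)}" by (rule finite_subset)
  then have "card (r ` \<D>) \<le> independence_number T"
    unfolding independence_number_def using mem by (rule Max_ge)
  then show ?thesis using card_image[OF inj] by simp
qed

text \<open>The tail \<open>a\<close> stays fixed, while \<open>s\<close> disjoint re-embeddings of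
  \<open>L\<close> would give the head \<open>b\<close> as many different images, all of them
  out-neighbours of \<open>f a\<close>.\<close>

lemma flexible_no_incoming:
  assumes D: "finite (D `` {f a})" "card (D `` {f a}) < s"
    and L: "b \<in> L" "a \<notin> L" "(a, b) \<in> A"
  shows "\<not> flexible A D W s f L"
proof
  assume "flexible A D W s f L"
  then obtain g where g: "\<forall>i<s. reembeds A D W L f (g i)" "\<forall>i<s. \<forall>j<i. g i ` L \<inter> g j ` L = {}"
    unfolding flexible_def by (elim exE conjE)
  have mem: "g i b \<in> D `` {f a}" if "i < s" for i
  proof -
    have "(override_on f (g i) L a, override_on f (g i) L b) \<in> D"
      using g(1) that L unfolding reembeds_def by blast
    then show ?thesis using L by (simp add: override_on_def)
  qed
  have "inj_on (\<lambda>i. g i b) {..<s}"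
  proof (rule linorder_inj_onI')
    fix i j assume ij: "i \<in> {..<s}" "j \<in> {..<s}" "i < j"
    then have "g j ` L \<inter> g i ` L = {}" using g(2) by simp
    then show "g i b \<noteq> g j b" using L(1) by (metis disjoint_iff imageI)
  qed
  then have "s \<le> card (D `` {f a})"
    using mem D(1) card_inj_on_le[of "\<lambda>i. g i b" "{..<s}" "D `` {f a}"] by auto
  then show False using D(2) by simp
qed

text \<open>An edge between two members would be directed into one of them, which then could not be
  flexible.\<close>

lemma flexible_scattered:
  assumes A: "\<And>a b. {a, b} \<in> edges T \<Longrightarrow> (a, b) \<in> A \<or> (b, a) \<in> A"
    and D: "\<And>x. finite (D `` {x}) \<and> card (D `` {x}) < s"
    and \<D>: "\<And>K. K \<in> \<D> \<Longrightarrow> K \<subseteq> verts T \<and> K \<noteq> {} \<and> flexible A D W s f K" "pairwise disjnt \<D>"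
  shows "scattered T \<D>"
proof -
  have "{a, b} \<notin> edges T" if K: "K \<in> \<D>" "L \<in> \<D>" "K \<noteq> L" "a \<in> K" "b \<in> L" for K L a b
  proof
    assume "{a, b} \<in> edges T"
    have ab: "a \<notin> L" "b \<notin> K" using K \<D>(2) by (auto simp: pairwise_def disjnt_def)
    from A[OF \<open>{a, b} \<in> edges T\<close>] show False
    proof
      assume "(a, b) \<in> A"
      then have "\<not> flexible A D W s f L" using flexible_no_incoming D K ab by metis
      then show False using \<D>(1) K by blast
    next
      assume "(b, a) \<in> A"
      then have "\<not> flexible A D W s f K" using flexible_no_incoming D K ab by metis
      then show False using \<D>(1) K by blast
    qed
  qed
  then show ?thesis using \<D> unfolding scattered_def by blast
qed

text \<open>The clones of a member are \<open>t\<close> of its re-embeddings, selected so that all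
  clones of all members avoid each other and the image of \<open>f\<close>. The bound on
  \<open>s\<close> pays for that image and for \<open>card \<D> * t\<close> sets of at most
  \<open>card (verts T)\<close> vertices.\<close>

lemma flexible_contains_blowup:
  assumes T: "graph T" and sc: "scattered T \<D>"
    and A: "\<And>a b. {a, b} \<in> edges T \<Longrightarrow> (a, b) \<in> A \<or> (b, a) \<in> A"
    and D: "\<And>x y. (x, y) \<in> D \<Longrightarrow> {x, y} \<in> edges G"
    and f: "embedding T G f"
    and fl: "\<And>K. K \<in> \<D> \<Longrightarrow> flexible A D (verts G) s f K"
    and s: "card (verts T) + card (verts T) * (card \<D> * t) < s"
  shows "contains_blowup T \<D> t G"
proof -
  let ?V = "verts T"
  have fV: "finite ?V" using T by (simp add: graph_def)
  have DV: "K \<subseteq> ?V" if "K \<in> \<D>" for K using sc that by (auto simp: scattered_def)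
  then have "\<D> \<subseteq> Pow ?V" by blast
  then have fD: "finite \<D>" using fV finite_subset by blast
  have fK: "finite K" "card K \<le> card ?V" if "K \<in> \<D>" for K
    using DV[OF that] fV by (auto intro: finite_subset card_mono)
  have "\<forall>K\<in>\<D>. \<exists>g. (\<forall>i<s. reembeds A D (verts G) K f (g i)) \<and> (\<forall>i<s. \<forall>j<i. g i ` K \<inter> g j ` K = {})"
    using fl by (simp add: flexible_def)
  then obtain g where g: "\<And>K i. K \<in> \<D> \<Longrightarrow> i < s \<Longrightarrow> reembeds A D (verts G) K f (g K i)"
    "\<And>K i j. K \<in> \<D> \<Longrightarrow> i < s \<Longrightarrow> j < i \<Longrightarrow> g K i ` K \<inter> g K j ` K = {}" by metis
  \<comment> \<open>The index \<open>(K, i)\<close> stands for the \<open>i\<close>-th clone of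
    \<open>K\<close>; option \<open>j\<close> is the image of its \<open>j\<close>-th
    re-embedding.\<close>
  define opt where "opt x j = g (fst x) j ` fst x" for x :: "'a set \<times> nat" and j
  have "\<exists>\<sigma>. (\<forall>x\<in>\<D> \<times> {..<t}. \<sigma> x < s \<and> opt x (\<sigma> x) \<inter> f ` ?V = {}) \<and>
    (\<forall>x\<in>\<D> \<times> {..<t}. \<forall>y\<in>\<D> \<times> {..<t}. x \<noteq> y \<longrightarrow> opt x (\<sigma> x) \<inter> opt y (\<sigma> y) = {})"
  proof (rule disjoint_representatives)
    show "card (f ` ?V) + card ?V * card (\<D> \<times> {..<t}) < s"
      using s card_image_le[OF fV, of f] by (simp add: card_cartesian_product)
    show "finite (opt x i) \<and> card (opt x i) \<le> card ?V" if "x \<in> \<D> \<times> {..<t}" "i < s" for x i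
      using fK[of "fst x"] card_image_le[of "fst x" "g (fst x) i"] that by (auto simp: opt_def)
    show "opt x i \<inter> opt x j = {}" if "x \<in> \<D> \<times> {..<t}" "i < s" "j < i" for x i j
      using g(2)[of "fst x" i j] that by (auto simp: opt_def mem_Times_iff)
  qed (use fD fV in auto)
  then obtain \<sigma> where \<sigma>0: "\<forall>x\<in>\<D> \<times> {..<t}. \<sigma> x < s \<and> opt x (\<sigma> x) \<inter> f ` ?V = {}"
    "\<forall>x\<in>\<D> \<times> {..<t}. \<forall>y\<in>\<D> \<times> {..<t}. x \<noteq> y \<longrightarrow> opt x (\<sigma> x) \<inter> opt y (\<sigma> y) = {}"
    by (elim exE conjE)
  have \<sigma>: "\<And>K i. K \<in> \<D> \<Longrightarrow> i < t \<Longrightarrow> \<sigma> (K, i) < s"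
    "\<And>K i. K \<in> \<D> \<Longrightarrow> i < t \<Longrightarrow> opt (K, i) (\<sigma> (K, i)) \<inter> f ` ?V = {}"
    "\<And>K i L j. K \<in> \<D> \<Longrightarrow> i < t \<Longrightarrow> L \<in> \<D> \<Longrightarrow> j < t \<Longrightarrow> (K, i) \<noteq> (L, j) \<Longrightarrow>
      opt (K, i) (\<sigma> (K, i)) \<inter> opt (L, j) (\<sigma> (L, j)) = {}"
    using \<sigma>0 by simp_all
  have uniq: "L = K" if "K \<in> \<D>" "L \<in> \<D>" "v \<in> K" "v \<in> L" for v K L
    using sc that by (auto simp: scattered_def pairwise_def disjnt_def)
  \<comment> \<open>Members are disjoint, so a vertex of the union lies in exactly one of
    them.\<close>
  define cl where "cl v = (SOME K. K \<in> \<D> \<and> v \<in> K)" for v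
  have cl: "cl v = K" if "K \<in> \<D>" "v \<in> K" for v K
    using someI[of "\<lambda>K. K \<in> \<D> \<and> v \<in> K" K] uniq that by (auto simp: cl_def)
  define \<phi> where "\<phi> v i = (if v \<in> \<Union>\<D> then g (cl v) (\<sigma> (cl v, i)) v else f v)" for v i
  have \<phi>K: "\<phi> v i = g K (\<sigma> (K, i)) v" if "K \<in> \<D>" "v \<in> K" for K v i
    using that cl[OF that] by (auto simp: \<phi>_def)
  have \<phi>_opt: "\<phi> v i \<in> opt (K, i) (\<sigma> (K, i))" if "K \<in> \<D>" "v \<in> K" for K v i
    using that by (simp add: \<phi>K opt_def)
  have \<phi>f: "\<phi> v i = f v" if "v \<notin> \<Union>\<D>" for v i using that by (simp add: \<phi>_def)
  have re: "reembeds A D (verts G) K f (g K (\<sigma> (K, i)))" if "K \<in> \<D>" "i < t" for K i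
    using g(1) \<sigma>(1) that by blast
  have v1: "\<phi> v i \<in> verts G" if "v \<in> ?V" "i < t" for v i
  proof (cases "v \<in> \<Union>\<D>")
    case True
    then obtain K where K: "K \<in> \<D>" "v \<in> K" by blast
    then show ?thesis using re[OF K(1) that(2)] \<phi>K[OF K] by (auto simp: reembeds_def)
  next
    case False
    then show ?thesis using f that by (auto simp: \<phi>f embedding_def)
  qed
  have v2: "u = v \<and> (u \<in> \<Union>\<D> \<longrightarrow> i = j)"
    if uv: "u \<in> ?V" "v \<in> ?V" "i < t" "j < t" "\<phi> u i = \<phi> v j" for u v i j
  proof (cases "u \<in> \<Union>\<D>")
    case True
    then obtain K where K: "K \<in> \<D>" "u \<in> K" by blast
    show ?thesis
    proof (cases "v \<in> \<Union>\<D>")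
      case True
      then obtain L where L: "L \<in> \<D>" "v \<in> L" by blast
      have "opt (K, i) (\<sigma> (K, i)) \<inter> opt (L, j) (\<sigma> (L, j)) \<noteq> {}"
        using \<phi>_opt[OF K, of i] \<phi>_opt[OF L, of j] uv(5) by auto
      then have eq: "K = L" "i = j" using \<sigma>(3) K L uv by blast+
      have "inj_on (g K (\<sigma> (K, i))) K" using re[OF K(1) uv(3)] by (simp add: reembeds_def)
      then have "u = v" using uv(5) \<phi>K[OF K] \<phi>K[OF L] eq K L by (auto simp: inj_on_def)
      then show ?thesis using eq by blast
    next
      case False
      then have "\<phi> u i \<in> f ` ?V" using uv \<phi>f by auto
      then show ?thesis using \<sigma>(2)[OF K(1) uv(3)] \<phi>_opt[OF K, of i] by blast
    qed
  next
    case False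
    show ?thesis
    proof (cases "v \<in> \<Union>\<D>")
      case True
      then obtain L where L: "L \<in> \<D>" "v \<in> L" by blast
      have "\<phi> v j \<in> f ` ?V" using uv \<phi>f[OF False] by (metis imageI)
      then show ?thesis using \<sigma>(2)[OF L(1) uv(4)] \<phi>_opt[OF L, of j] by blast
    next
      case v: False
      then show ?thesis using uv \<phi>f[OF v] \<phi>f[OF False] f False by (auto simp: embedding_def inj_on_def)
    qed
  qed
  have v4': "{\<phi> u i, \<phi> v i} \<in> edges G" if e: "{u, v} \<in> edges T" "i < t" "u \<in> \<Union>\<D>" for u v i
  proof -
    obtain K where K: "K \<in> \<D>" "u \<in> K" using e by blast
    \<comment> \<open>The other endpoint is either cloned together with \<open>u\<close> or not
      cloned at all; in both cases the hybrid map of the single member \<open>K\<close> describes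
      both ends.\<close>
    have v: "v \<in> K \<or> v \<notin> \<Union>\<D>" using sc K e(1) unfolding scattered_def by blast
    let ?h = "override_on f (g K (\<sigma> (K, i))) K"
    have h: "?h u = \<phi> u i" "?h v = \<phi> v i"
      using K v \<phi>K[OF K(1)] \<phi>f by (auto simp: override_on_def)
    have "(?h u, ?h v) \<in> D \<or> (?h v, ?h u) \<in> D"
      using re[OF K(1) e(2)] A[OF e(1)] K(2) unfolding reembeds_def by blast
    then show ?thesis using D h by (metis insert_commute)
  qed
  have v4: "{\<phi> u i, \<phi> v i} \<in> edges G" if e: "{u, v} \<in> edges T" "i < t" for u v i
  proof -
    consider "u \<in> \<Union>\<D>" | "v \<in> \<Union>\<D>" | "u \<notin> \<Union>\<D>" "v \<notin> \<Union>\<D>" by blast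
    then show ?thesis
    proof cases
      case 1
      then show ?thesis using v4' e by blast
    next
      case 2
      then show ?thesis using v4'[of v u i] e by (simp add: insert_commute)
    next
      case 3
      then show ?thesis using f e by (simp add: \<phi>f embedding_def)
    qed
  qed
  show ?thesis
    unfolding contains_blowup_def
  proof (intro exI[of _ \<phi>] conjI)
    show "\<forall>v\<in>?V. \<forall>i<t. \<phi> v i \<in> verts G" using v1 by blast
    show "\<forall>u\<in>?V. \<forall>v\<in>?V. \<forall>i<t. \<forall>j<t. \<phi> u i = \<phi> v j \<longrightarrow> u = v \<and> (u \<in> \<Union>\<D> \<longrightarrow> i = j)"
      using v2 by simp
    show "\<forall>v\<in>?V - \<Union>\<D>. \<forall>i. \<phi> v i = \<phi> v 0" using \<phi>f by simp
    show "\<forall>u v. {u, v} \<in> edges T \<longrightarrow> (\<forall>i<t. {\<phi> u i, \<phi> v i} \<in> edges G)" using v4 by simp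
  qed
qed

section \<open>Upper and lower bounds for the number of copies\<close>

lemma finite_embeddings:
  assumes "graph T" "graph G"
  shows "finite {f \<in> extensional (verts T). embedding T G f}"
proof (rule finite_subset)
  show "{f \<in> extensional (verts T). embedding T G f} \<subseteq> verts T \<rightarrow>\<^sub>E verts G"
    by (auto simp: embedding_def PiE_def)
  show "finite (verts T \<rightarrow>\<^sub>E verts G)"
    using assms by (simp add: graph_def finite_PiE)
qed

lemma copies_eq_image_graphs:
  assumes "graph T" "graph G"
  shows "{H. subgraph H G \<and> graph_iso H T} =
    (\<lambda>f. image_graph f T) ` {f \<in> extensional (verts T). embedding T G f}"
proof (intro equalityI subsetI)
  fix H assume "H \<in> {H. subgraph H G \<and> graph_iso H T}"
  then obtain f where "f \<in> extensional (verts T)" "embedding T G f" "H = image_graph f T"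
    using copy_is_image_graph[OF assms(1)] by blast
  then show "H \<in> (\<lambda>f. image_graph f T) ` {f \<in> extensional (verts T). embedding T G f}" by blast
next
  fix H assume "H \<in> (\<lambda>f. image_graph f T) ` {f \<in> extensional (verts T). embedding T G f}"
  then obtain f where "embedding T G f" "H = image_graph f T" by blast
  then show "H \<in> {H. subgraph H G \<and> graph_iso H T}"
    by (simp add: subgraph_image_graph[OF assms] graph_iso_image_graph[OF assms(1)] embedding_def)
qed

text \<open>Each embedding determines an orientation of \<open>T\<close> and, by duality, a set
  \<open>S\<close> meeting all its flexible subtrees; the matching packing yields a blow-up, so
  \<open>S\<close> has at most \<open>k\<close> vertices. There are at most
  \<open>2 ^ (N * N) * 2 ^ N\<close> such pairs, and the embeddings of each pair are counted by
  their values on \<open>S\<close>.\<close>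

lemma num_copies_le:
  assumes T: "forest T" and G: "graph G" "verts G \<noteq> {}"
    and D: "\<And>x y. (x, y) \<in> D \<Longrightarrow> {x, y} \<in> edges G"
      "\<And>x y. {x, y} \<in> edges G \<Longrightarrow> (x, y) \<in> D \<or> (y, x) \<in> D" "\<And>x. card (D `` {x}) \<le> m"
    and noblowup: "\<And>\<D>. scattered T \<D> \<Longrightarrow> contains_blowup T \<D> t G \<Longrightarrow> card \<D> \<le> k"
    and N: "N = card (verts T)" and s: "s = Suc (N + N * (2 ^ N * t) + m)"
  shows "num_copies T G \<le> 2 ^ (N * N) * 2 ^ N * Suc (N * (s * N)) ^ N * card (verts G) ^ k"
proof -
  let ?V = "verts T" and ?W = "verts G"
  let ?c = "card ?W ^ k * Suc (N * (s * N)) ^ N"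
  define Emb where "Emb = {f \<in> extensional ?V. embedding T G f}"
  have gT: "graph T" using T by (simp add: forest_def)
  have fV: "finite ?V" and fW: "finite ?W" using gT G by (auto simp: graph_def)
  have fEmb: "finite Emb" unfolding Emb_def using gT G by (intro finite_embeddings)
  have D': "finite (D `` {x}) \<and> card (D `` {x}) < s" for x
  proof -
    have "D `` {x} \<subseteq> ?W" using D(1) graph_edgeD[OF G(1)] by blast
    then have "finite (D `` {x})" using fW finite_subset by blast
    then show ?thesis using D(3)[of x] s by simp
  qed
  \<comment> \<open>Embeddings for which the pair \<open>p\<close> of orientation and transversal
    works. The classes may overlap; covering all embeddings is enough.\<close>
  define \<Phi> where "\<Phi> p = {f \<in> Emb. (\<forall>(a, b)\<in>fst p. (f a, f b) \<in> D \<and> {a, b} \<in> edges T) \<and> card (snd p) \<le> k \<and>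
    (\<forall>K. K \<subseteq> ?V - snd p \<longrightarrow> conn (edges T) K \<longrightarrow> \<not> flexible (fst p) D ?W s f K)}" for p
  let ?I = "Pow (?V \<times> ?V) \<times> Pow ?V"
  have fI: "finite ?I" using fV by simp
  have cI: "card ?I = 2 ^ (N * N) * 2 ^ N" using fV N by (simp add: card_cartesian_product card_Pow)
  have cover: "Emb \<subseteq> (\<Union>p\<in>?I. \<Phi> p)"
  proof
    fix f assume f: "f \<in> Emb"
    have emb: "embedding T G f" using f by (simp add: Emb_def)
    \<comment> \<open>Edges of \<open>T\<close> are directed as \<open>D\<close> directs their
      images.\<close>
    define A where "A = {(a, b). {a, b} \<in> edges T \<and> (f a, f b) \<in> D}"
    have A: "(a, b) \<in> A \<or> (b, a) \<in> A" if "{a, b} \<in> edges T" for a b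
      using that emb D(2)[of "f a" "f b"] by (auto simp: A_def embedding_def insert_commute)
    define \<K> where "\<K> = {K. K \<subseteq> ?V \<and> conn (edges T) K \<and> flexible A D ?W s f K}"
    have "\<exists>S \<D>. S \<subseteq> ?V \<and> \<D> \<subseteq> \<K> \<and> (\<forall>K\<in>\<K>. K \<inter> S \<noteq> {}) \<and> pairwise disjnt \<D> \<and> card S \<le> card \<D>"
      by (rule subtrees_transversal[OF forest_peelable[OF T]]) (simp add: \<K>_def)
    then obtain S \<D> where S: "S \<subseteq> ?V" "\<D> \<subseteq> \<K>" "\<forall>K\<in>\<K>. K \<inter> S \<noteq> {}" "pairwise disjnt \<D>" "card S \<le> card \<D>"
      by (elim exE conjE)
    have \<D>: "K \<subseteq> ?V \<and> K \<noteq> {} \<and> flexible A D ?W s f K" if "K \<in> \<D>" for K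
      using that S(2) by (auto simp: \<K>_def conn_def)
    have sc: "scattered T \<D>" using flexible_scattered[OF A D' \<D> S(4)] .
    \<comment> \<open>The crude bound \<open>2 ^ N\<close> on the size of the packing lets one
      \<open>s\<close> serve every embedding.\<close>
    have "card \<D> \<le> card (Pow ?V)" using \<D> fV by (intro card_mono) auto
    then have "N + N * (card \<D> * t) \<le> N + N * (2 ^ N * t)"
      using fV N by (simp add: card_Pow)
    then have lt: "card ?V + card ?V * (card \<D> * t) < s" unfolding N[symmetric] using s by linarith
    have "contains_blowup T \<D> t G"
      by (rule flexible_contains_blowup[where D = D, OF gT sc A D(1) emb _ lt]) (simp_all add: \<D>)
    then have "card S \<le> k" using noblowup[OF sc] S(5) by simp
    moreover have "\<not> flexible A D ?W s f K" if "K \<subseteq> ?V - S" "conn (edges T) K" for K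
    proof
      assume "flexible A D ?W s f K"
      then have "K \<in> \<K>" using that by (auto simp: \<K>_def)
      then show False using S(3) that(1) by blast
    qed
    ultimately have "f \<in> \<Phi> (A, S)" using f by (auto simp: \<Phi>_def A_def)
    moreover have "A \<subseteq> ?V \<times> ?V" using graph_edgeD[OF gT] by (auto simp: A_def)
    ultimately show "f \<in> (\<Union>p\<in>?I. \<Phi> p)" using S(1) by blast
  qed
  have \<Phi>_le: "card (\<Phi> p) \<le> ?c" if p: "p \<in> ?I" for p
  proof (cases "\<Phi> p = {}")
    case True
    then show ?thesis by simp
  next
    case False
    obtain A S where AS: "p = (A, S)" by fastforce
    from False obtain f where f: "f \<in> \<Phi> p" by blast
    have k: "card S \<le> k" using f AS by (auto simp: \<Phi>_def)
    have AE: "{a, b} \<in> edges T" if "(a, b) \<in> A" for a b using that f AS by (auto simp: \<Phi>_def)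
    have "card (\<Phi> p) \<le> card ?W ^ card S * Suc (card ?V * (s * card ?V)) ^ card ?V"
    proof (rule card_embeddings_le[OF fV _ AE])
      show "f \<in> extensional ?V \<and> inj_on f ?V \<and> f ` ?V \<subseteq> ?W \<and> (\<forall>(a, b)\<in>A. (f a, f b) \<in> D)"
        if "f \<in> \<Phi> p" for f
        using that AS by (auto simp: \<Phi>_def Emb_def embedding_def)
      show "\<not> flexible A D ?W s f K" if "f \<in> \<Phi> p" "K \<subseteq> ?V - S" "conn (edges T) K" for f K
        using that AS by (auto simp: \<Phi>_def)
    qed (use p AS fW in auto)
    also have "\<dots> \<le> ?c"
    proof -
      have "1 \<le> card ?W" using G(2) fW by (simp add: Suc_le_eq card_gt_0_iff)
      then have "card ?W ^ card S \<le> card ?W ^ k" using k by (simp add: power_increasing)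
      then show ?thesis using N by simp
    qed
    finally show ?thesis .
  qed
  have "num_copies T G \<le> card Emb"
    unfolding num_copies_def copies_eq_image_graphs[OF gT G(1)] Emb_def[symmetric]
    by (rule card_image_le[OF fEmb])
  also have "\<dots> \<le> card (\<Union>p\<in>?I. \<Phi> p)"
  proof (rule card_mono[OF _ cover])
    have "finite (\<Phi> p)" for p using fEmb by (simp add: \<Phi>_def)
    then show "finite (\<Union>p\<in>?I. \<Phi> p)" using fI by blast
  qed
  also have "\<dots> \<le> (\<Sum>p\<in>?I. card (\<Phi> p))" by (rule card_UN_le[OF fI])
  also have "\<dots> \<le> of_nat (card ?I) * ?c" using \<Phi>_le by (rule sum_bounded_above)
  finally show ?thesis unfolding cI by (simp add: mult_ac)
qed

text \<open>The host is cut down to \<open>n\<close> vertices including all clones. Choosing a clone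
  index for each member independently then gives \<open>t ^ card \<D>\<close> copies, which differ
  already in their vertex sets.\<close>

lemma exists_subgraph_many_copies:
  assumes T: "graph T" and sc: "scattered T \<D>" and bl: "contains_blowup T \<D> t G" and t: "1 \<le> t"
    and G: "graph G" and n: "card (verts T) * t \<le> n" "n \<le> card (verts G)"
  shows "\<exists>G'. subgraph G' G \<and> card (verts G') = n \<and> t ^ card \<D> \<le> num_copies T G'"
proof -
  let ?V = "verts T"
  obtain \<phi> where \<phi>: "\<forall>v\<in>?V. \<forall>i<t. \<phi> v i \<in> verts G"
     "\<forall>u\<in>?V. \<forall>v\<in>?V. \<forall>i<t. \<forall>j<t. \<phi> u i = \<phi> v j \<longrightarrow> u = v \<and> (u \<in> \<Union>\<D> \<longrightarrow> i = j)"
     "\<forall>v\<in>?V - \<Union>\<D>. \<forall>i. \<phi> v i = \<phi> v 0"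
     "\<forall>u v. {u, v} \<in> edges T \<longrightarrow> (\<forall>i<t. {\<phi> u i, \<phi> v i} \<in> edges G)"
    using bl unfolding contains_blowup_def by (elim exE conjE)
  have fV: "finite ?V" and fG: "finite (verts G)" using T G by (auto simp: graph_def)
  let ?U = "(\<lambda>(v, i). \<phi> v i) ` (?V \<times> {..<t})"
  have "card ?U \<le> card (?V \<times> {..<t})" using fV by (intro card_image_le) simp
  then have cU: "card ?U \<le> n" using n by (simp add: card_cartesian_product)
  have UG: "?U \<subseteq> verts G" using \<phi>(1) by auto
  obtain W where W: "?U \<subseteq> W" "W \<subseteq> verts G" "card W = n"
    using exists_subset_between[OF cU n(2) UG fG] by blast
  define G' where "G' = \<lparr>verts = W, edges = {e \<in> edges G. e \<subseteq> W}\<rparr>"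
  have "graph G'" using G W(2) fG by (auto simp: graph_def G'_def nsets_def intro: finite_subset)
  then have sub: "subgraph G' G" using G W(2) by (auto simp: subgraph_def G'_def)
  have uniq: "L = K" if "K \<in> \<D>" "L \<in> \<D>" "v \<in> K" "v \<in> L" for v K L
    using sc that by (auto simp: scattered_def pairwise_def disjnt_def)
  define cl where "cl v = (SOME K. K \<in> \<D> \<and> v \<in> K)" for v
  have cl: "cl v = K" if "K \<in> \<D>" "v \<in> K" for v K
    using someI[of "\<lambda>K. K \<in> \<D> \<and> v \<in> K" K] uniq that by (auto simp: cl_def)
  let ?J = "\<D> \<rightarrow>\<^sub>E {..<t}"
  \<comment> \<open>The default 0 is the index of the single image of an uncloned vertex;
    \<open>1 \<le> t\<close> makes it legal.\<close>
  define idx where "idx j v = (if v \<in> \<Union>\<D> then j (cl v) else 0)" for j :: "'a set \<Rightarrow> nat" and v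
  have idxK: "idx j v = j K" if "K \<in> \<D>" "v \<in> K" for j v K
    using that cl[OF that] by (auto simp: idx_def)
  have idx_less: "idx j v < t" if "j \<in> ?J" for j v
  proof (cases "v \<in> \<Union>\<D>")
    case True
    then obtain K where "K \<in> \<D>" "v \<in> K" by blast
    then show ?thesis using that idxK by auto
  next
    case False
    then show ?thesis using t by (simp add: idx_def)
  qed
  define f where "f j = restrict (\<lambda>v. \<phi> v (idx j v)) ?V" for j
  have f_mem: "f j v \<in> W" if "j \<in> ?J" "v \<in> ?V" for j v
    using W(1) idx_less[OF that(1), of v] that(2) by (auto simp: f_def)
  have emb: "embedding T G' (f j)" if j: "j \<in> ?J" for j
    unfolding embedding_def
  proof (intro conjI allI impI)
    show "inj_on (f j) ?V"
    proof (rule inj_onI)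
      fix u v assume uv: "u \<in> ?V" "v \<in> ?V" "f j u = f j v"
      then have "\<phi> u (idx j u) = \<phi> v (idx j v)" by (simp add: f_def)
      then show "u = v" using \<phi>(2) idx_less[OF j] uv(1,2) by blast
    qed
    show "f j ` ?V \<subseteq> verts G'" using f_mem[OF j] by (auto simp: G'_def)
    fix u v assume e: "{u, v} \<in> edges T"
    have uv: "u \<in> ?V" "v \<in> ?V" using graph_edgeD[OF T e] by auto
    \<comment> \<open>The blow-up joins clones of equal index only, so both ends must be read at a
      common index. An uncloned end looks the same at every index and adopts that of the
      other.\<close>
    have "\<exists>i<t. f j u = \<phi> u i \<and> f j v = \<phi> v i"
    proof (cases "u \<in> \<Union>\<D>")
      case u: True
      then obtain K where K: "K \<in> \<D>" "u \<in> K" by blast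
      have "v \<in> K \<or> v \<notin> \<Union>\<D>" using sc K e unfolding scattered_def by blast
      then have "f j v = \<phi> v (j K)"
      proof
        assume "v \<in> K"
        then show ?thesis using uv idxK[OF K(1)] by (simp add: f_def)
      next
        assume "v \<notin> \<Union>\<D>"
        then have "\<phi> v (idx j v) = \<phi> v 0" "\<phi> v (j K) = \<phi> v 0" using \<phi>(3) uv by blast+
        then show ?thesis using uv by (simp add: f_def)
      qed
      moreover have "f j u = \<phi> u (j K)" using uv idxK[OF K] by (simp add: f_def)
      ultimately show ?thesis using idx_less[OF j, of u] idxK[OF K] by metis
    next
      case False
      then have "\<phi> u (idx j v) = \<phi> u 0" "\<phi> u (idx j u) = \<phi> u 0" using \<phi>(3) uv by blast+
      then show ?thesis using uv idx_less[OF j, of v] by (intro exI[of _ "idx j v"]) (simp add: f_def)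
    qed
    then have "{f j u, f j v} \<in> edges G" using \<phi>(4) e by metis
    then show "{f j u, f j v} \<in> edges G'" using f_mem[OF j] uv by (simp add: G'_def)
  qed
  have inj: "inj_on (\<lambda>j. image_graph (f j) T) ?J"
  proof (rule inj_onI)
    fix j j' assume j: "j \<in> ?J" "j' \<in> ?J" "image_graph (f j) T = image_graph (f j') T"
    then have im: "f j ` ?V = f j' ` ?V" by (simp add: image_graph_def)
    show "j = j'"
    proof (rule PiE_ext[OF j(1,2)])
      fix K assume K: "K \<in> \<D>"
      then have "K \<noteq> {}" "K \<subseteq> ?V" using sc by (auto simp: scattered_def)
      then obtain v where v: "v \<in> K" "v \<in> ?V" by blast
      \<comment> \<open>Clones of different vertices or indices are distinct, so the vertex set of a
        copy reveals the index chosen for \<open>K\<close>.\<close>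
      then obtain u where u: "u \<in> ?V" "f j v = f j' u" using im by blast
      then have "\<phi> v (idx j v) = \<phi> u (idx j' u)" using v by (simp add: f_def)
      then have "v = u" "idx j v = idx j' u" using \<phi>(2) u v K idx_less j by blast+
      then show "j K = j' K" using idxK[OF K] v by metis
    qed
  qed
  have fD: "finite \<D>" using sc fV by (auto simp: scattered_def intro: finite_subset[of _ "Pow ?V"])
  have "t ^ card \<D> = card ?J" using fD by (simp add: card_PiE)
  also have "\<dots> = card ((\<lambda>j. image_graph (f j) T) ` ?J)" using card_image[OF inj] by simp
  also have "\<dots> \<le> card {H. subgraph H G' \<and> graph_iso H T}"
  proof (rule card_mono)
    show "finite {H. subgraph H G' \<and> graph_iso H T}"
      using copies_eq_image_graphs[OF T \<open>graph G'\<close>] finite_embeddings[OF T \<open>graph G'\<close>] by simp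
    have "f j \<in> extensional ?V" for j by (simp add: f_def)
    then show "(\<lambda>j. image_graph (f j) T) ` ?J \<subseteq> {H. subgraph H G' \<and> graph_iso H T}"
      unfolding copies_eq_image_graphs[OF T \<open>graph G'\<close>] using emb by blast
  qed
  finally show ?thesis using sub W(3) by (auto simp: num_copies_def G'_def)
qed

section \<open>The dichotomy for the extremal number\<close>

lemma num_copies_le_ex_num:
  fixes G :: "nat ugraph"
  assumes "graph G" "free_of \<F> G"
  shows "num_copies T G \<le> ex_num (card (verts G)) T \<F>"
proof -
  have "num_copies T G \<in> copy_counts (card (verts G)) T \<F>"
    using assms by (auto simp: copy_counts_def)
  then show ?thesis using Max_ge[OF finite_copy_counts] by (auto simp: ex_num_def simp del: Max_ge_iff)
qed

lemma ex_num_le: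
  assumes "\<And>G :: nat ugraph. graph G \<Longrightarrow> card (verts G) = n \<Longrightarrow> free_of \<F> G \<Longrightarrow> num_copies T G \<le> B"
  shows "ex_num n T \<F> \<le> B"
proof (cases "copy_counts n T \<F> = {}")
  case False
  then have "Max (copy_counts n T \<F>) \<in> copy_counts n T \<F>" using finite_copy_counts by (intro Max_in)
  then show ?thesis using assms False by (auto simp: ex_num_def copy_counts_def)
qed (simp add: ex_num_def)

theorem corollary2p6:
  fixes T :: "'a ugraph" and \<F> :: "'b ugraph set"
  assumes "tree T" and "\<not> graph_iso T (complete_graph 1)"
    and "\<forall>F\<in>\<F>. graph F" and "\<exists>F\<in>\<F>. forest F"
  shows "(\<exists>k::int. k \<le> int (independence_number T) \<and>
            (\<lambda>n. real (ex_num n T \<F>)) \<in> \<Theta>(\<lambda>n. real n powi k)) \<or>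
         (\<forall>\<^sub>F n in sequentially. ex_num n T \<F> = 0)"
proof -
  have T: "forest T" "graph T" "verts T \<noteq> {}"
    using assms(1) by (auto simp: tree_def forest_def connected_graph_def)
  obtain F where F: "F \<in> \<F>" "forest F" using assms(4) by blast
  have fV: "finite (verts T)" using T by (simp add: graph_def)
  define N where "N = card (verts T)"
  have N: "N > 0" using T fV by (simp add: N_def card_gt_0_iff)
  \<comment> \<open>Hosts must have arbitrarily many vertices as well as arbitrarily many clones, so
    that an \<open>n\<close>-vertex subgraph can be taken for every \<open>n\<close>; for the empty
    family only the first condition makes the host large.\<close>
  define Good where "Good \<D> \<longleftrightarrow> scattered T \<D> \<and> (\<forall>t. \<exists>G :: nat ugraph. graph G \<and> free_of \<F> G \<and>
    t \<le> card (verts G) \<and> contains_blowup T \<D> t G)" for \<D>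
  have "{\<D>. scattered T \<D>} \<subseteq> Pow (Pow (verts T))" by (auto simp: scattered_def)
  then have fsc: "finite {\<D>. scattered T \<D>}" using fV by (meson finite_Pow_iff finite_subset)
  have fGood: "finite (Collect Good)" by (rule finite_subset[OF _ fsc]) (auto simp: Good_def)
  show ?thesis
  proof (cases "Collect Good = {}")
    case True
    \<comment> \<open>An embedding of \<open>T\<close> is a blow-up for the empty family, so failure
      of \<open>Good {}\<close> excludes \<open>T\<close> from all large \<open>\<F>\<close>-free
      graphs.\<close>
    then have "\<not> Good {}" by blast
    moreover have "scattered T {}" by (simp add: scattered_def)
    ultimately obtain t where t: "\<And>G :: nat ugraph. graph G \<Longrightarrow> free_of \<F> G \<Longrightarrow> t \<le> card (verts G) \<Longrightarrow>
      \<not> contains_blowup T {} t G" unfolding Good_def by blast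
    have "ex_num n T \<F> = 0" if n: "t \<le> n" for n
    proof -
      have "ex_num n T \<F> \<le> 0"
      proof (rule ex_num_le)
        fix G :: "nat ugraph" assume G: "graph G" "card (verts G) = n" "free_of \<F> G"
        have "\<not> embedding T G f" for f
        proof
          assume "embedding T G f"
          then have "contains_blowup T {} t G"
            unfolding contains_blowup_def
            by (intro exI[of _ "\<lambda>v i. f v"]) (auto simp: embedding_def inj_on_def)
          then show False using t G n by blast
        qed
        then show "num_copies T G \<le> 0"
          unfolding num_copies_def copies_eq_image_graphs[OF T(2) G(1)] by simp
      qed
      then show ?thesis by simp
    qed
    then show ?thesis unfolding eventually_sequentially by blast
  next
    case False
    define k where "k = Max (card ` Collect Good)"
    have "k \<in> card ` Collect Good" unfolding k_def using fGood False by (intro Max_in) auto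
    then obtain \<D> where \<D>: "Good \<D>" "card \<D> = k" by blast
    have sc: "scattered T \<D>" using \<D> by (simp add: Good_def)
    have k_max: "card \<D>' \<le> k" if "Good \<D>'" for \<D>'
      unfolding k_def using fGood that by (intro Max_ge) auto
    \<comment> \<open>A scattered family with more than \<open>k\<close> members is not good. This
      gives a threshold: no host with at least that many vertices contains a blow-up with that many
      clones.\<close>
    have "\<exists>t. \<forall>G :: nat ugraph. graph G \<longrightarrow> free_of \<F> G \<longrightarrow> t \<le> card (verts G) \<longrightarrow> k < card \<D>' \<longrightarrow>
      \<not> contains_blowup T \<D>' t G" if "scattered T \<D>'" for \<D>'
      using k_max[of \<D>'] that unfolding Good_def by (meson leD)
    then obtain \<tau> where \<tau>: "\<And>\<D>' G. scattered T \<D>' \<Longrightarrow> graph (G :: nat ugraph) \<Longrightarrow> free_of \<F> G \<Longrightarrow>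
      \<tau> \<D>' \<le> card (verts G) \<Longrightarrow> k < card \<D>' \<Longrightarrow> \<not> contains_blowup T \<D>' (\<tau> \<D>') G" by metis
    \<comment> \<open>The sum dominates the thresholds of the finitely many families;
      \<open>Suc\<close> ensures that hosts with at least \<open>t\<close> vertices are
      nonempty.\<close>
    define t where "t = Suc (\<Sum>\<D>' | scattered T \<D>'. \<tau> \<D>')"
    have \<tau>_le: "\<tau> \<D>' \<le> t" if "scattered T \<D>'" for \<D>'
      using member_le_sum[of \<D>' "{\<D>. scattered T \<D>}" \<tau>] that fsc by (simp add: t_def)
    define s where "s = Suc (N + N * (2 ^ N * t) + card (verts F))"
    define C where "C = 2 ^ (N * N) * 2 ^ N * Suc (N * (s * N)) ^ N"
    have upper: "ex_num n T \<F> \<le> C * n ^ k" if n: "t \<le> n" for n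
    proof (rule ex_num_le)
      fix G :: "nat ugraph" assume G: "graph G" "card (verts G) = n" "free_of \<F> G"
      obtain D where D: "\<forall>x y. (x, y) \<in> D \<longrightarrow> {x, y} \<in> edges G"
        "\<forall>x y. {x, y} \<in> edges G \<longrightarrow> (x, y) \<in> D \<or> (y, x) \<in> D" "\<forall>x. card (D `` {x}) \<le> card (verts F)"
        using forest_free_orientation[OF G(1) F(2,1) G(3)] by (elim exE conjE)
      have ne: "verts G \<noteq> {}" using G(2) n by (auto simp: t_def)
      have nb: "card \<D>' \<le> k" if "scattered T \<D>'" "contains_blowup T \<D>' t G" for \<D>'
        using \<tau>[OF that(1) G(1,3)] \<tau>_le[OF that(1)] contains_blowup_mono[OF that(2)] G(2) n by force
      have "num_copies T G \<le> C * card (verts G) ^ k"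
        unfolding C_def
        by (rule num_copies_le[OF T(1) G(1) ne D(1)[rule_format] D(2)[rule_format] D(3)[rule_format] nb N_def s_def])
      then show "num_copies T G \<le> C * n ^ k" using G(2) by simp
    qed
    \<comment> \<open>Goodness at parameter \<open>n\<close> supplies a host with at least
      \<open>n\<close> vertices. Thinned to \<open>n div N\<close> clones, its blow-up occupies at
      most \<open>n\<close> vertices and fits into an \<open>n\<close>-vertex subgraph.\<close>
    have lower: "(n div N) ^ k \<le> ex_num n T \<F>" if n: "N \<le> n" for n
    proof -
      obtain G :: "nat ugraph" where G: "graph G" "free_of \<F> G" "n \<le> card (verts G)" "contains_blowup T \<D> n G"
        using \<D>(1) unfolding Good_def by blast
      have "contains_blowup T \<D> (n div N) G" using G(4) by (rule contains_blowup_mono) simp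
      moreover have "1 \<le> n div N" using n N by (simp add: Suc_le_eq div_greater_zero_iff)
      moreover have "card (verts T) * (n div N) \<le> n" by (simp add: N_def[symmetric])
      ultimately obtain G' where G': "subgraph G' G" "card (verts G') = n" "(n div N) ^ card \<D> \<le> num_copies T G'"
        using exists_subgraph_many_copies[OF T(2) sc _ _ G(1) _ G(3)] by blast
      have "graph G'" "free_of \<F> G'" using G' G free_of_subgraph by (auto simp: subgraph_def)
      then show ?thesis using num_copies_le_ex_num[of G' \<F> T] G' \<D>(2) by simp
    qed
    have "(\<lambda>n. real (ex_num n T \<F>)) \<in> O(\<lambda>n. real n powi int k)"
    proof (rule landau_o.bigI[of "real (Suc C)"])
      show "\<forall>\<^sub>F n in sequentially. norm (real (ex_num n T \<F>)) \<le> real (Suc C) * norm (real n powi int k)"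
        unfolding eventually_sequentially
      proof (intro exI[of _ t] allI impI)
        fix n assume "t \<le> n"
        then have "ex_num n T \<F> \<le> Suc C * n ^ k" using upper[of n] by simp
        then have "real (ex_num n T \<F>) \<le> real (Suc C * n ^ k)" by (rule of_nat_mono)
        then show "norm (real (ex_num n T \<F>)) \<le> real (Suc C) * norm (real n powi int k)"
            by (simp add: algebra_simps)
      qed
    qed simp
    moreover have "(\<lambda>n. real (ex_num n T \<F>)) \<in> \<Omega>(\<lambda>n. real n powi int k)"
    \<comment> \<open>For \<open>n \<ge> N\<close>, rounding down loses at most a factor of two:
      \<open>n \<le> 2 * (N * (n div N))\<close>.\<close>
    proof (rule landau_omega.bigI[of "(1 / (2 * real N)) ^ k"])
      show "\<forall>\<^sub>F n in sequentially. norm (real (ex_num n T \<F>)) \<ge> (1 / (2 * real N)) ^ k * norm (real n powi int k)"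
        unfolding eventually_sequentially
      proof (intro exI[of _ N] allI impI)
        fix n assume n: "N \<le> n"
        have "n div N \<ge> 1" using n N by (simp add: Suc_le_eq div_greater_zero_iff)
        then have "N \<le> N * (n div N)" by simp
        moreover have "n < N * (n div N) + N"
          using N mod_less_divisor[OF N, of n] mult_div_mod_eq[of N n] by linarith
        ultimately have "n \<le> 2 * (N * (n div N))" by linarith
        then have "real n \<le> real (2 * (N * (n div N)))" by (rule of_nat_mono)
        then have "1 / (2 * real N) * real n \<le> real (n div N)" using N by (simp add: field_simps)
        then have "(1 / (2 * real N) * real n) ^ k \<le> real (n div N) ^ k" by (intro power_mono) auto
        also have "\<dots> = real ((n div N) ^ k)" by simp
        also have "\<dots> \<le> real (ex_num n T \<F>)" using lower[OF n] by (rule of_nat_mono)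
        finally show "norm (real (ex_num n T \<F>)) \<ge> (1 / (2 * real N)) ^ k * norm (real n powi int k)"
          by (simp add: power_mult_distrib[symmetric])
      qed
    qed (use N in simp)
    ultimately have "(\<lambda>n. real (ex_num n T \<F>)) \<in> \<Theta>(\<lambda>n. real n powi int k)" by (rule bigthetaI)
    moreover have "int k \<le> int (independence_number T)"
      using scattered_card_le_independence_number[OF T(2) sc] \<D>(2) by simp
    ultimately show ?thesis by blast
  qed
qed

end
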